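(* Let $a,b,c$ be unlabeled graph combinations such that $b\neq0$, and $b$ and $c$ are sos-testable. If $ab=c$, then $a$ is sos-testable.
   Context: Graphs are finite, simple. $t(H;G)$ is the probability that a uniformly random map $V(H)\to V(G)$ maps edges to edges. A partially labeled graph is a graph without isolated vertices in which some vertices receive distinct labels from $\{1,2,\ldots\}$ (unlabeled if none); the empty graph is $1$. A graph combination is a finite formal $\mathbb R$-linear combination of partially labeled graphs; the product glues vertices with equal labels keeping one copy of doubled edges (for unlabeled graphs it is disjoint union), extended bilinearly; $[[\cdot]]$ removes all labels. For unlabeled $a=\sum\alpha_iH_i$, $a(G)=\sum\alpha_it(H_i;G)$. A $d$-sos graph combination is $\sum_j[[a_j^2]]$ where every constituent graph of every $a_j$ has at most $d$ edges. Fix $\ell(d)$ such that every $d$-sos combination can be written using labels only in $\{1,\ldots,\ell(d)\}$. $\mathcal B_d$: $1$ and all partially labeled graphs with labels in $\{1,\ldots,\ell(d)\}$, at most $d$ edges, no isolated vertices; $\mathcal V_d=\{[[AB]]\text{ connected}: A,B\in\mathcal B_d\}\setminus\{1\}$, $s=|\mathcal V_d|$. An unlabeled graph all of whose components lie in $\mathcal V_d$ is the monomial $\prod x_C$ over its components, evaluated at $\mathbf v\in\mathbb{R}^s$ by $x_C\mapsto v_C$; $d$-sos combinations are such polynomials. The $d$-sos-profile is $\mathcal S_d=\{\mathbf v\in\mathbb{R}^s_{\ge0}: a(\mathbf v)\ge0$ for every $d$-sos graph combination $a\}$. An unlabeled graph combination $a$ is sos-testable if for some $d$ (with all connected components of constituent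 graphs of $a$ in $\mathcal V_d$) we have $a(\mathbf v)\ge0$ for all $\mathbf v\in\mathcal S_d$. *)

theory Defs
  imports Complex_Main "HOL-Library.Poly_Mapping" "HOL-Library.Multiset" "HOL-Library.FuncSet"
begin

section \<open>Partially labeled graphs\<close>

text \<open>
  A vertex is either the (unique) vertex carrying the label \<open>n\<close>, written \<open>Lab n\<close>, or an
  unlabeled vertex \<open>Unl n\<close> whose index \<open>n\<close> is irrelevant up to isomorphism.  Since there
  are no isolated vertices, a graph is given by its edge set \<open>E\<close>; its vertex set is \<open>\<Union>E\<close>.
\<close>

datatype vert = Lab nat | Unl nat

definition is_plgraph :: "vert set set \<Rightarrow> bool" where
  "is_plgraph E \<longleftrightarrow> finite E \<and> (\<forall>e\<in>E. card e = 2 \<and> Lab 0 \<notin> e)"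

definition plgraph_iso :: "vert set set \<Rightarrow> vert set set \<Rightarrow> bool" where
  "plgraph_iso E F \<longleftrightarrow> is_plgraph E \<and> is_plgraph F \<and>
     (\<exists>f. inj_on f (\<Union>E) \<and> (\<forall>x\<in>\<Union>E. \<forall>n. f x = Lab n \<longleftrightarrow> x = Lab n) \<and> F = (`) f ` E)"

lemma plgraph_isoI:
  assumes E: "is_plgraph E" and inj: "inj_on f (\<Union>E)"
    and lab: "\<And>x n. x \<in> \<Union>E \<Longrightarrow> f x = Lab n \<longleftrightarrow> x = Lab n"
    and F: "F = (`) f ` E"
  shows "plgraph_iso E F"
proof -
  have "card (f ` e) = 2 \<and> Lab 0 \<notin> f ` e" if "e \<in> E" for e
  proof -
    have "inj_on f e" using inj that by (meson Union_upper inj_on_subset)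
    moreover have "card e = 2" "Lab 0 \<notin> e" using E that by (auto simp: is_plgraph_def)
    moreover have "Lab 0 \<notin> f ` e" using lab that \<open>Lab 0 \<notin> e\<close> by (metis UnionI imageE)
    ultimately show ?thesis by (simp add: card_image)
  qed
  then have "is_plgraph F" using E by (auto simp: is_plgraph_def F)
  then show ?thesis unfolding plgraph_iso_def using assms by blast
qed

lemma plgraph_isoE:
  assumes "plgraph_iso E F"
  obtains f where "is_plgraph E" "is_plgraph F" "inj_on f (\<Union>E)"
    "\<And>x n. x \<in> \<Union>E \<Longrightarrow> f x = Lab n \<longleftrightarrow> x = Lab n" "F = (`) f ` E"
  using assms unfolding plgraph_iso_def by blast

lemma plgraph_iso_refl: "is_plgraph E \<Longrightarrow> plgraph_iso E E"
  by (rule plgraph_isoI[where f = "\<lambda>x. x"]) auto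

lemma plgraph_iso_sym: "plgraph_iso E F \<Longrightarrow> plgraph_iso F E"
proof (erule plgraph_isoE)
  fix f
  assume E: "is_plgraph E" and Fg: "is_plgraph F" and inj: "inj_on f (\<Union>E)"
    and lab: "\<And>x n. x \<in> \<Union>E \<Longrightarrow> f x = Lab n \<longleftrightarrow> x = Lab n" and F: "F = (`) f ` E"
  let ?g = "inv_into (\<Union>E) f"
  have UF: "\<Union>F = f ` \<Union>E" unfolding F by blast
  have "?g ` f ` e = e" if "e \<in> E" for e
    using that inj by (simp add: Union_upper inv_into_image_cancel)
  then have "(`) ?g ` F = E" by (force simp: F image_iff)
  moreover have "?g x = Lab n \<longleftrightarrow> x = Lab n" if x: "x \<in> \<Union>F" for x n
  proof -
    obtain y where y: "y \<in> \<Union>E" "x = f y" using x UF by blast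
    then have "?g x = y" using inj by simp
    then show ?thesis using lab y by simp
  qed
  moreover have "inj_on ?g (\<Union>F)" by (simp add: UF inj_on_inv_into)
  ultimately show ?thesis using plgraph_isoI[OF Fg, of ?g E] by simp
qed

lemma plgraph_iso_trans:
  assumes "plgraph_iso E F" "plgraph_iso F G"
  shows "plgraph_iso E G"
proof -
  obtain f where f: "is_plgraph E" "inj_on f (\<Union>E)"
    "\<And>x n. x \<in> \<Union>E \<Longrightarrow> f x = Lab n \<longleftrightarrow> x = Lab n" "F = (`) f ` E"
    using assms(1) by (rule plgraph_isoE) blast
  obtain g where g: "inj_on g (\<Union>F)"
    "\<And>x n. x \<in> \<Union>F \<Longrightarrow> g x = Lab n \<longleftrightarrow> x = Lab n" "G = (`) g ` F"
    using assms(2) by (rule plgraph_isoE) blast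
  have UF: "\<Union>F = f ` \<Union>E" unfolding f(4) by blast
  show ?thesis
  proof (rule plgraph_isoI[OF f(1)])
    show "inj_on (g \<circ> f) (\<Union>E)" using f(2) g(1) UF by (simp add: comp_inj_on)
    show "(g \<circ> f) x = Lab n \<longleftrightarrow> x = Lab n" if "x \<in> \<Union>E" for x n
      using f(3)[OF that] g(2)[of "f x"] UF that by simp
    show "G = (`) (g \<circ> f) ` E" by (simp add: g(3) f(4) image_image)
  qed
qed

text \<open>Partially labeled graphs, taken up to label-preserving isomorphism.\<close>

quotient_type plgraph = "vert set set" / partial: plgraph_iso
proof (rule part_equivpI)
  show "\<exists>E. plgraph_iso E E"
    by (rule exI[of _ "{}"], rule plgraph_iso_refl) (simp add: is_plgraph_def)
  show "symp plgraph_iso" by (rule sympI) (rule plgraph_iso_sym)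
  show "transp plgraph_iso" by (rule transpI) (rule plgraph_iso_trans)
qed

lift_definition num_edges :: "plgraph \<Rightarrow> nat" is card
proof (erule plgraph_isoE)
  fix E F :: "vert set set" and f
  assume inj: "inj_on f (\<Union>E)" and F: "F = (`) f ` E"
  have "inj_on ((`) f) E"
    by (rule inj_onI) (metis Union_upper inj inj_on_image_eq_iff)
  then show "card E = card F" by (simp add: F card_image)
qed

lift_definition labels :: "plgraph \<Rightarrow> nat set" is "\<lambda>E. {n. Lab n \<in> \<Union>E}"
proof (erule plgraph_isoE)
  fix E F :: "vert set set" and f
  assume lab: "\<And>x n. x \<in> \<Union>E \<Longrightarrow> f x = Lab n \<longleftrightarrow> x = Lab n" and F: "F = (`) f ` E"
  have UF: "\<Union>F = f ` \<Union>E" unfolding F by blast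
  show "{n. Lab n \<in> \<Union>E} = {n. Lab n \<in> \<Union>F}"
    unfolding UF using lab by (metis (no_types, lifting) image_iff)
qed

definition unlabeled :: "plgraph \<Rightarrow> bool" where
  "unlabeled G \<longleftrightarrow> labels G = {}"

text \<open>The map \<open>[[\<cdot>]]\<close> on graphs: all vertices, renamed injectively, become unlabeled.\<close>

fun drop_label :: "vert \<Rightarrow> vert" where
  "drop_label (Lab n) = Unl (2 * n)"
| "drop_label (Unl n) = Unl (2 * n + 1)"

lemma drop_label_eq_iff [simp]: "drop_label x = drop_label y \<longleftrightarrow> x = y"
  by (cases x; cases y; simp; presburger)

lemma drop_label_neq_Lab [simp]: "drop_label x \<noteq> Lab n"
  by (cases x) auto

lemma is_plgraph_image:
  assumes "is_plgraph E" "inj_on f (\<Union>E)" "Lab 0 \<notin> f ` \<Union>E"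
  shows "is_plgraph ((`) f ` E)"
proof -
  have "card (f ` e) = 2" if "e \<in> E" for e
    using assms that by (metis Union_upper card_image inj_on_subset is_plgraph_def)
  then show ?thesis using assms by (auto simp: is_plgraph_def)
qed

lift_definition unlabel :: "plgraph \<Rightarrow> plgraph" is "\<lambda>E. (`) drop_label ` E"
proof (erule plgraph_isoE)
  fix E F :: "vert set set" and f
  assume E: "is_plgraph E" and inj: "inj_on f (\<Union>E)" and F: "F = (`) f ` E"
  let ?g = "drop_label \<circ> f \<circ> inv drop_label"
  have d: "inj drop_label" by (simp add: inj_on_def)
  have U: "\<Union>((`) drop_label ` E) = drop_label ` \<Union>E" by blast
  show "plgraph_iso ((`) drop_label ` E) ((`) drop_label ` F)"
  proof (rule plgraph_isoI[where f = ?g])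
    show "is_plgraph ((`) drop_label ` E)"
      by (rule is_plgraph_image[OF E]) (auto simp: inj_on_def, metis drop_label_neq_Lab)
    show "inj_on ?g (\<Union>((`) drop_label ` E))"
      unfolding U using inj by (auto simp: inj_on_def d)
    show "?g x = Lab n \<longleftrightarrow> x = Lab n" if "x \<in> \<Union>((`) drop_label ` E)" for x n
      using that unfolding U by auto
    show "(`) drop_label ` F = (`) ?g ` (`) drop_label ` E"
      by (simp add: F image_image d)
  qed
qed

subsection \<open>Product\<close>

text \<open>
  The product glues equal labels: the unlabeled vertices are made disjoint, whereas vertices
  with equal labels (and edges between them) coincide in the union.
\<close>

fun shiftL :: "vert \<Rightarrow> vert" where
  "shiftL (Lab n) = Lab n"
| "shiftL (Unl n) = Unl (2 * n)"

fun shiftR :: "vert \<Rightarrow> vert" where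
  "shiftR (Lab n) = Lab n"
| "shiftR (Unl n) = Unl (2 * n + 1)"

definition glue :: "vert set set \<Rightarrow> vert set set \<Rightarrow> vert set set" where
  "glue E F = (`) shiftL ` E \<union> (`) shiftR ` F"

lemma shift_eq_iff [simp]:
  "shiftL x = shiftL y \<longleftrightarrow> x = y" "shiftR x = shiftR y \<longleftrightarrow> x = y"
  "shiftL x = Lab n \<longleftrightarrow> x = Lab n" "shiftR x = Lab n \<longleftrightarrow> x = Lab n"
  "Lab n = shiftL x \<longleftrightarrow> x = Lab n" "Lab n = shiftR x \<longleftrightarrow> x = Lab n"
  by (cases x; cases y; auto)+

lemma shiftL_eq_shiftR_iff: "shiftL x = shiftR y \<longleftrightarrow> (\<exists>n. x = Lab n \<and> y = Lab n)"
  by (cases x; cases y; simp; presburger)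

lemma shiftR_eq_shiftL_iff: "shiftR x = shiftL y \<longleftrightarrow> (\<exists>n. x = Lab n \<and> y = Lab n)"
  by (metis shiftL_eq_shiftR_iff)

lemma shiftL_or_shiftR: "(\<exists>u. z = shiftL u) \<or> (\<exists>u. z = shiftR u)"
proof (cases z)
  case (Lab n)
  then have "z = shiftL (Lab n)" by simp
  then show ?thesis by blast
next
  case (Unl n)
  then have "z = shiftL (Unl (n div 2)) \<or> z = shiftR (Unl (n div 2))"
    by (cases "even n") auto
  then show ?thesis by blast
qed

lemma Union_glue: "\<Union>(glue E F) = shiftL ` \<Union>E \<union> shiftR ` \<Union>F"
  by (auto simp: glue_def)

lemma is_plgraph_Un: "is_plgraph E \<Longrightarrow> is_plgraph F \<Longrightarrow> is_plgraph (E \<union> F)"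
  by (auto simp: is_plgraph_def)

lemma is_plgraph_Lab0: "is_plgraph E \<Longrightarrow> Lab 0 \<notin> \<Union>E"
  by (auto simp: is_plgraph_def)

lemma is_plgraph_glue: "is_plgraph E \<Longrightarrow> is_plgraph F \<Longrightarrow> is_plgraph (glue E F)"
  unfolding glue_def
  by (intro is_plgraph_Un is_plgraph_image) (auto simp: inj_on_def dest: is_plgraph_Lab0)

lemma glue_cong:
  assumes "plgraph_iso E E'" "plgraph_iso F F'"
  shows "plgraph_iso (glue E F) (glue E' F')"
proof -
  obtain f where f: "is_plgraph E" "inj_on f (\<Union>E)"
    "\<And>x n. x \<in> \<Union>E \<Longrightarrow> f x = Lab n \<longleftrightarrow> x = Lab n" "E' = (`) f ` E"
    using assms(1) by (rule plgraph_isoE) blast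
  obtain g where g: "is_plgraph F" "inj_on g (\<Union>F)"
    "\<And>x n. x \<in> \<Union>F \<Longrightarrow> g x = Lab n \<longleftrightarrow> x = Lab n" "F' = (`) g ` F"
    using assms(2) by (rule plgraph_isoE) blast
  define h where "h x = (case x of Lab n \<Rightarrow> Lab n
    | Unl n \<Rightarrow> if even n then shiftL (f (Unl (n div 2))) else shiftR (g (Unl (n div 2))))" for x
  have hL: "h (shiftL x) = shiftL (f x)" if "x \<in> \<Union>E" for x
    using f(3)[OF that] by (cases x) (auto simp: h_def)
  have hR: "h (shiftR x) = shiftR (g x)" if "x \<in> \<Union>F" for x
    using g(3)[OF that] by (cases x) (auto simp: h_def)
  show ?thesis
  proof (rule plgraph_isoI[OF is_plgraph_glue[OF f(1) g(1)]])
    show "inj_on h (\<Union>(glue E F))"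
    proof (rule inj_onI)
      fix x y assume x: "x \<in> \<Union>(glue E F)" and y: "y \<in> \<Union>(glue E F)" and eq: "h x = h y"
      have "(\<exists>a\<in>\<Union>E. x = shiftL a) \<or> (\<exists>a\<in>\<Union>F. x = shiftR a)" using x by (auto simp: Union_glue)
      moreover have "(\<exists>a\<in>\<Union>E. y = shiftL a) \<or> (\<exists>a\<in>\<Union>F. y = shiftR a)"
        using y by (auto simp: Union_glue)
      moreover have "x = y" if "a \<in> \<Union>E" "x = shiftL a" "b \<in> \<Union>E" "y = shiftL b" for a b
        using that eq hL f(2) by (metis inj_onD shift_eq_iff(1))
      moreover have "x = y" if "a \<in> \<Union>F" "x = shiftR a" "b \<in> \<Union>F" "y = shiftR b" for a b
        using that eq hR g(2) by (metis inj_onD shift_eq_iff(2))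
      moreover have "x = y" if "a \<in> \<Union>E" "x = shiftL a" "b \<in> \<Union>F" "y = shiftR b" for a b
        using that eq hL hR f(3) g(3) by (metis shiftL.simps(1) shiftL_eq_shiftR_iff shiftR.simps(1))
      moreover have "x = y" if "a \<in> \<Union>F" "x = shiftR a" "b \<in> \<Union>E" "y = shiftL b" for a b
        using that eq hL hR f(3) g(3) by (metis shiftL.simps(1) shiftL_eq_shiftR_iff shiftR.simps(1))
      ultimately show "x = y" by blast
    qed
    show "h x = Lab n \<longleftrightarrow> x = Lab n" if "x \<in> \<Union>(glue E F)" for x n
    proof -
      have "(\<exists>a\<in>\<Union>E. x = shiftL a) \<or> (\<exists>a\<in>\<Union>F. x = shiftR a)" using that by (auto simp: Union_glue)
      then show ?thesis
      proof
        assume "\<exists>a\<in>\<Union>E. x = shiftL a"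
        then obtain a where "a \<in> \<Union>E" "x = shiftL a" by blast
        then show ?thesis by (simp only: hL shift_eq_iff f(3))
      next
        assume "\<exists>a\<in>\<Union>F. x = shiftR a"
        then obtain a where "a \<in> \<Union>F" "x = shiftR a" by blast
        then show ?thesis by (simp only: hR shift_eq_iff g(3))
      qed
    qed
    have "h ` shiftL ` e = shiftL ` f ` e" if "e \<in> E" for e
      using that by (force simp: image_image intro!: image_cong hL)
    moreover have "h ` shiftR ` e = shiftR ` g ` e" if "e \<in> F" for e
      using that by (force simp: image_image intro!: image_cong hR)
    ultimately show "glue E' F' = (`) h ` glue E F"
      by (simp add: glue_def f(4) g(4) image_Un image_image cong: image_cong_simp)
  qed
qed

text \<open>
  The monoid of partially labeled graphs under the product is written additively (the empty
  graph being \<open>0\<close>), so that the convolution product of \<open>plgraph \<Rightarrow>\<^sub>0 real\<close> is the bilinear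
  extension of the product of graphs.
\<close>

instantiation plgraph :: comm_monoid_add
begin

lift_definition zero_plgraph :: plgraph is "{}"
  by (rule plgraph_iso_refl) (simp add: is_plgraph_def)

lift_definition plus_plgraph :: "plgraph \<Rightarrow> plgraph \<Rightarrow> plgraph" is glue
  by (rule glue_cong)

instance
proof
  fix a b c :: plgraph
  show "a + b + c = a + (b + c)"
  proof transfer
    fix E F G assume "plgraph_iso E E" "plgraph_iso F F" "plgraph_iso G G"
    then have "is_plgraph E" "is_plgraph F" "is_plgraph G" by (auto simp: plgraph_iso_def)
    define h where "h x = (case x of Lab n \<Rightarrow> Lab n
      | Unl n \<Rightarrow> if odd n then Unl (2 * n + 1)
          else if even (n div 2) then Unl (n div 2) else Unl (n - 1))" for x
    have "h (shiftL (shiftL x)) = shiftL x" "h (shiftL (shiftR x)) = shiftR (shiftL x)"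
      "h (shiftR x) = shiftR (shiftR x)" for x
      by (cases x; simp add: h_def)+
    note h = this
    show "plgraph_iso (glue (glue E F) G) (glue E (glue F G))"
    proof (rule plgraph_isoI)
      show "is_plgraph (glue (glue E F) G)" by (intro is_plgraph_glue) fact+
      have "inj h"
      proof (rule injI)
        fix x y assume eq: "h x = h y"
        have "(\<exists>u. z = shiftL (shiftL u)) \<or> (\<exists>u. z = shiftL (shiftR u)) \<or> (\<exists>u. z = shiftR u)" for z
          by (metis shiftL_or_shiftR)
        from this[of x] this[of y] eq show "x = y"
          by (elim disjE exE) (auto simp: h shiftL_eq_shiftR_iff shiftR_eq_shiftL_iff)
      qed
      then show "inj_on h (\<Union>(glue (glue E F) G))" by (rule inj_on_subset) simp
      show "h x = Lab n \<longleftrightarrow> x = Lab n" for x n by (cases x) (auto simp: h_def)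
      show "glue E (glue F G) = (`) h ` glue (glue E F) G"
        by (simp add: glue_def image_Un image_image h Un_assoc)
    qed
  qed
  show "a + b = b + a"
  proof transfer
    fix E F assume "plgraph_iso E E" "plgraph_iso F F"
    then have "is_plgraph E" "is_plgraph F" by (auto simp: plgraph_iso_def)
    define h where "h x = (case x of Lab n \<Rightarrow> Lab n
      | Unl n \<Rightarrow> if odd n then Unl (n - 1) else Unl (n + 1))" for x
    have h: "h (shiftL x) = shiftR x" "h (shiftR x) = shiftL x" for x
      by (cases x; simp add: h_def)+
    show "plgraph_iso (glue E F) (glue F E)"
    proof (rule plgraph_isoI)
      show "is_plgraph (glue E F)" by (intro is_plgraph_glue) fact+
      have "inj h"
      proof (rule injI)
        fix x y assume "h x = h y"
        with shiftL_or_shiftR[of x] shiftL_or_shiftR[of y] show "x = y"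
          by (auto simp: h shiftL_eq_shiftR_iff shiftR_eq_shiftL_iff)
      qed
      then show "inj_on h (\<Union>(glue E F))" by (rule inj_on_subset) simp
      show "h x = Lab n \<longleftrightarrow> x = Lab n" for x n by (cases x) (auto simp: h_def)
      show "glue F E = (`) h ` glue E F"
        by (simp add: glue_def image_Un image_image h Un_commute)
    qed
  qed
  show "0 + a = a"
  proof transfer
    fix E assume "plgraph_iso E E"
    then have "is_plgraph E" by (auto simp: plgraph_iso_def)
    then have "plgraph_iso E (glue {} E)"
      by (rule plgraph_isoI[where f = shiftR]) (auto simp: glue_def inj_on_def)
    then show "plgraph_iso (glue {} E) E" by (rule plgraph_iso_sym)
  qed
qed

end

subsection \<open>Connected components\<close>

definition adj :: "vert set set \<Rightarrow> vert rel" where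
  "adj E = {(u, v). {u, v} \<in> E}"

definition edge_components :: "vert set set \<Rightarrow> vert set set set" where
  "edge_components E = (\<lambda>W. {e \<in> E. e \<subseteq> W}) ` (\<Union>E // (adj E)\<^sup>*)"

lemma adj_rtrancl_image:
  assumes "(u, v) \<in> (adj E)\<^sup>*"
  shows "(f u, f v) \<in> (adj ((`) f ` E))\<^sup>*"
  using assms
proof (induction rule: rtrancl_induct)
  case (step y z)
  then have "f ` {y, z} \<in> (`) f ` E" unfolding adj_def by blast
  then have "(f y, f z) \<in> adj ((`) f ` E)" by (simp add: adj_def)
  with step.IH show ?case by (rule rtrancl_into_rtrancl)
qed simp

lemma adj_rtrancl_closed: "(u, v) \<in> (adj E)\<^sup>* \<Longrightarrow> u \<in> \<Union>E \<Longrightarrow> v \<in> \<Union>E"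
  by (induction rule: rtrancl_induct) (auto simp: adj_def)

lemma adj_rtrancl_image_iff:
  assumes "inj_on f (\<Union>E)" "u \<in> \<Union>E" "v \<in> \<Union>E"
  shows "(f u, f v) \<in> (adj ((`) f ` E))\<^sup>* \<longleftrightarrow> (u, v) \<in> (adj E)\<^sup>*"
proof
  assume "(f u, f v) \<in> (adj ((`) f ` E))\<^sup>*"
  then have "(inv_into (\<Union>E) f (f u), inv_into (\<Union>E) f (f v))
      \<in> (adj ((`) (inv_into (\<Union>E) f) ` (`) f ` E))\<^sup>*"
    by (rule adj_rtrancl_image)
  moreover have "(`) (inv_into (\<Union>E) f) ` (`) f ` E = E"
  proof -
    have "inv_into (\<Union>E) f ` f ` e = e" if "e \<in> E" for e
      using that assms(1) by (simp add: Union_upper inv_into_image_cancel)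
    then show ?thesis by (force simp: image_iff)
  qed
  ultimately show "(u, v) \<in> (adj E)\<^sup>*" using assms by simp
qed (rule adj_rtrancl_image)

lift_definition connected_graph :: "plgraph \<Rightarrow> bool" is
  "\<lambda>E. \<forall>u\<in>\<Union>E. \<forall>v\<in>\<Union>E. (u, v) \<in> (adj E)\<^sup>*"
proof (erule plgraph_isoE)
  fix E F :: "vert set set" and f
  assume inj: "inj_on f (\<Union>E)" and F: "F = (`) f ` E"
  have UF: "\<Union>F = f ` \<Union>E" unfolding F by blast
  show "(\<forall>u\<in>\<Union>E. \<forall>v\<in>\<Union>E. (u, v) \<in> (adj E)\<^sup>*) = (\<forall>u\<in>\<Union>F. \<forall>v\<in>\<Union>F. (u, v) \<in> (adj F)\<^sup>*)"
    unfolding UF unfolding F using adj_rtrancl_image_iff[OF inj] by blast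
qed

lemma edge_components_image:
  assumes inj: "inj_on f (\<Union>E)"
  shows "edge_components ((`) f ` E) = (\<lambda>C. (`) f ` C) ` edge_components E"
proof -
  let ?F = "(`) f ` E"
  have UF: "\<Union>?F = f ` \<Union>E" by blast
  have cls: "(adj ?F)\<^sup>* `` {f u} = f ` ((adj E)\<^sup>* `` {u})" if u: "u \<in> \<Union>E" for u
  proof (intro set_eqI iffI)
    fix y assume "y \<in> (adj ?F)\<^sup>* `` {f u}"
    then have r: "(f u, y) \<in> (adj ?F)\<^sup>*" by simp
    then have "y \<in> f ` \<Union>E" using adj_rtrancl_closed[OF r] u UF by blast
    then obtain v where v: "v \<in> \<Union>E" "y = f v" by blast
    with r have "(u, v) \<in> (adj E)\<^sup>*" using adj_rtrancl_image_iff[OF inj u] by simp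
    then show "y \<in> f ` ((adj E)\<^sup>* `` {u})" using v by blast
  next
    fix y assume "y \<in> f ` ((adj E)\<^sup>* `` {u})"
    then show "y \<in> (adj ?F)\<^sup>* `` {f u}" using adj_rtrancl_image[of u _ E f] by blast
  qed
  have ed: "{e \<in> ?F. e \<subseteq> f ` W} = (`) f ` {e \<in> E. e \<subseteq> W}" if W: "W \<subseteq> \<Union>E" for W
  proof -
    have "f ` e \<subseteq> f ` W \<longleftrightarrow> e \<subseteq> W" if "e \<in> E" for e
      using inj_on_image_mem_iff[OF inj _ W] that by blast
    then show ?thesis by blast
  qed
  have "edge_components ?F = (\<lambda>u. {e \<in> ?F. e \<subseteq> (adj ?F)\<^sup>* `` {f u}}) ` \<Union>E"
    unfolding edge_components_def quotient_def UF by blast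
  also have "\<dots> = (\<lambda>u. (`) f ` {e \<in> E. e \<subseteq> (adj E)\<^sup>* `` {u}}) ` \<Union>E"
  proof (rule image_cong[OF refl])
    fix u assume u: "u \<in> \<Union>E"
    then have "(adj E)\<^sup>* `` {u} \<subseteq> \<Union>E" using adj_rtrancl_closed by blast
    then show "{e \<in> ?F. e \<subseteq> (adj ?F)\<^sup>* `` {f u}} = (`) f ` {e \<in> E. e \<subseteq> (adj E)\<^sup>* `` {u}}"
      by (simp only: cls[OF u] ed)
  qed
  also have "\<dots> = (\<lambda>C. (`) f ` C) ` edge_components E"
    unfolding edge_components_def quotient_def by blast
  finally show ?thesis .
qed

lift_definition components :: "plgraph \<Rightarrow> plgraph multiset" is
  "\<lambda>E. image_mset abs_plgraph (mset_set (edge_components E))"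
proof (erule plgraph_isoE)
  fix E F :: "vert set set" and f
  assume E: "is_plgraph E" and inj: "inj_on f (\<Union>E)" and F: "F = (`) f ` E"
    and lab: "\<And>x n. x \<in> \<Union>E \<Longrightarrow> f x = Lab n \<longleftrightarrow> x = Lab n"
  let ?g = "\<lambda>C. (`) f ` C"
  have sub: "C \<subseteq> E" if "C \<in> edge_components E" for C
    using that by (auto simp: edge_components_def)
  have "inj_on ((`) f) E"
    by (rule inj_onI) (metis Union_upper inj inj_on_image_eq_iff)
  then have "inj_on ?g (edge_components E)"
    by (intro inj_onI) (metis sub inj_on_image_eq_iff)
  then have "mset_set (edge_components F) = image_mset ?g (mset_set (edge_components E))"
    by (simp add: F edge_components_image[OF inj] image_mset_mset_set)
  moreover have "abs_plgraph (?g C) = abs_plgraph C" if C: "C \<in> edge_components E" for C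
  proof -
    have *: "is_plgraph C" using E sub[OF C] finite_subset by (auto simp: is_plgraph_def)
    have UC: "\<Union>C \<subseteq> \<Union>E" using sub[OF C] by blast
    have "plgraph_iso C (?g C)"
    proof (rule plgraph_isoI[OF *])
      show "inj_on f (\<Union>C)" using inj UC by (rule inj_on_subset)
      show "f x = Lab n \<longleftrightarrow> x = Lab n" if "x \<in> \<Union>C" for x n
        using lab UC that by blast
    qed simp
    then show ?thesis using Quotient3_rel_abs[OF Quotient3_plgraph] by metis
  qed
  moreover have "finite (edge_components E)"
  proof (rule finite_subset)
    show "edge_components E \<subseteq> Pow E" using sub by blast
    show "finite (Pow E)" using E by (simp add: is_plgraph_def)
  qed
  ultimately show "image_mset abs_plgraph (mset_set (edge_components E))
      = image_mset abs_plgraph (mset_set (edge_components F))"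
    by (auto simp: image_mset.compositionality intro!: image_mset_cong)
qed

section \<open>Graph combinations\<close>

type_synonym graph_comb = "plgraph \<Rightarrow>\<^sub>0 real"

definition unlabeled_comb :: "graph_comb \<Rightarrow> bool" where
  "unlabeled_comb a \<longleftrightarrow> (\<forall>G\<in>Poly_Mapping.keys a. unlabeled G)"

definition unlabel_comb :: "graph_comb \<Rightarrow> graph_comb" where
  "unlabel_comb a =
     (\<Sum>G\<in>Poly_Mapping.keys a. Poly_Mapping.single (unlabel G) (Poly_Mapping.lookup a G))"

definition is_sos :: "nat \<Rightarrow> graph_comb \<Rightarrow> bool" where
  "is_sos d s \<longleftrightarrow> (\<exists>as :: graph_comb list.
     (\<forall>a\<in>set as. \<forall>G\<in>Poly_Mapping.keys a. num_edges G \<le> d) \<and>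
     s = (\<Sum>a\<leftarrow>as. unlabel_comb (a\<^sup>2)))"

definition is_sos_labels :: "nat \<Rightarrow> nat \<Rightarrow> graph_comb \<Rightarrow> bool" where
  "is_sos_labels l d s \<longleftrightarrow> (\<exists>as :: graph_comb list.
     (\<forall>a\<in>set as. \<forall>G\<in>Poly_Mapping.keys a. num_edges G \<le> d \<and> labels G \<subseteq> {1..l}) \<and>
     s = (\<Sum>a\<leftarrow>as. unlabel_comb (a\<^sup>2)))"

definition label_bound :: "(nat \<Rightarrow> nat) \<Rightarrow> bool" where
  "label_bound l \<longleftrightarrow> (\<forall>d s. is_sos d s \<longrightarrow> is_sos_labels (l d) d s)"

section \<open>Profiles and testability\<close>

definition \<B> :: "(nat \<Rightarrow> nat) \<Rightarrow> nat \<Rightarrow> plgraph set" where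
  "\<B> l d = {G. labels G \<subseteq> {1..l d} \<and> num_edges G \<le> d}"

text \<open>Here \<open>A + B\<close> is the product of graphs and \<open>0\<close> is the empty graph.\<close>

definition \<V> :: "(nat \<Rightarrow> nat) \<Rightarrow> nat \<Rightarrow> plgraph set" where
  "\<V> l d = {unlabel (A + B) | A B. A \<in> \<B> l d \<and> B \<in> \<B> l d \<and> connected_graph (unlabel (A + B))} - {0}"

definition eval_graph :: "(plgraph \<Rightarrow> real) \<Rightarrow> plgraph \<Rightarrow> real" where
  "eval_graph v G = (\<Prod>C\<in>#components G. v C)"

definition eval_comb :: "(plgraph \<Rightarrow> real) \<Rightarrow> graph_comb \<Rightarrow> real" where
  "eval_comb v a = (\<Sum>G\<in>Poly_Mapping.keys a. Poly_Mapping.lookup a G * eval_graph v G)"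

text \<open>
  A vector with coordinates indexed by \<open>\<V> l d\<close> is an extensional function on \<open>\<V> l d\<close>.
\<close>

definition sos_profile :: "(nat \<Rightarrow> nat) \<Rightarrow> nat \<Rightarrow> (plgraph \<Rightarrow> real) set" where
  "sos_profile l d = {v \<in> \<V> l d \<rightarrow>\<^sub>E {0..}. \<forall>a. is_sos d a \<longrightarrow> eval_comb v a \<ge> 0}"

definition sos_testable :: "(nat \<Rightarrow> nat) \<Rightarrow> graph_comb \<Rightarrow> bool" where
  "sos_testable l a \<longleftrightarrow> unlabeled_comb a \<and> (\<exists>d.
     (\<forall>G\<in>Poly_Mapping.keys a. set_mset (components G) \<subseteq> \<V> l d) \<and>
     (\<forall>v\<in>sos_profile l d. eval_comb v a \<ge> 0))"

end

theory Submission
  imports "HOL-Computational_Algebra.Polynomial" "HOL-Probability.Product_PMF" Defs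
begin

text \<open>
  Let \<open>v\<close> lie in the \<open>d\<close>-sos-profile. If \<open>b(v) > 0\<close> then \<open>a(v) = c(v) / b(v) \<ge> 0\<close>, so it suffices to
  approximate \<open>v\<close> by points of the profile at which \<open>b\<close> does not vanish. Treating \<open>v\<close> like a
  graphon, let \<open>v\<^sub>s\<close> be the densities of the disjoint union of \<open>v\<close>, scaled to mass \<open>1 - s\<close>, and of a
  weighted graph \<open>G\<close>, scaled to mass \<open>s\<close>. Mapping the vertices at random and conditioning on the
  images of the labeled ones shows that \<open>v\<^sub>s\<close> stays in the profile. Now \<open>a(v\<^sub>s)\<close> and \<open>b(v\<^sub>s)\<close> are
  polynomials in \<open>s\<close>, at \<open>s = 0\<close> we recover \<open>v\<close>, and at \<open>s = 1\<close> we get \<open>b(G)\<close>, which is nonzero for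
  a suitable \<open>G\<close>. Hence \<open>b(v\<^sub>s) \<noteq> 0\<close> for all small \<open>s > 0\<close>, while \<open>a(v\<^sub>s)\<close> tends to \<open>a(v)\<close> as \<open>s\<close>
  tends to \<open>0\<close>.
\<close>

section \<open>Graphs and their edge sets\<close>

lemma plgraph_iso_refl_iff: "plgraph_iso E E \<longleftrightarrow> is_plgraph E"
  using plgraph_iso_refl by (auto simp: plgraph_iso_def)

lemma abs_plgraph_eqI: "plgraph_iso E F \<Longrightarrow> abs_plgraph E = abs_plgraph F"
  by (rule Quotient3_rel_abs[OF Quotient3_plgraph])

lemma abs_rep_plgraph [simp]: "abs_plgraph (rep_plgraph G) = G"
  by (rule Quotient3_abs_rep[OF Quotient3_plgraph])

lemma is_plgraph_rep [simp]: "is_plgraph (rep_plgraph G)"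
  using Quotient3_rep_reflp[OF Quotient3_plgraph] by (simp add: plgraph_iso_refl_iff)

lemma plgraph_iso_rep_abs: "is_plgraph E \<Longrightarrow> plgraph_iso E (rep_plgraph (abs_plgraph E))"
  using Quotient3_rep_abs[OF Quotient3_plgraph] plgraph_iso_refl plgraph_iso_sym by blast

lemma plgraph_exhaust [cases type: plgraph]:
  obtains (abs_plgraph) E where "is_plgraph E" "G = abs_plgraph E"
  using is_plgraph_rep abs_rep_plgraph by metis

lemmas plgraph_abs_simps =
  plus_plgraph.abs_eq[unfolded plgraph_iso_refl_iff] unlabel.abs_eq[unfolded plgraph_iso_refl_iff]
  components.abs_eq[unfolded plgraph_iso_refl_iff] num_edges.abs_eq[unfolded plgraph_iso_refl_iff]
  labels.abs_eq[unfolded plgraph_iso_refl_iff] connected_graph.abs_eq[unfolded plgraph_iso_refl_iff]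

lemma num_edges_rep: "num_edges G = card (rep_plgraph G)"
  using plgraph_abs_simps(4)[OF is_plgraph_rep] by simp

lemma is_plgraph_empty [simp]: "is_plgraph {}"
  by (simp add: is_plgraph_def)

lemma is_plgraph_finite: "is_plgraph E \<Longrightarrow> finite E"
  by (simp add: is_plgraph_def)

lemma is_plgraph_edge_nonempty: "is_plgraph E \<Longrightarrow> e \<in> E \<Longrightarrow> e \<noteq> {}"
  by (auto simp: is_plgraph_def)

lemma is_plgraph_finite_verts: "is_plgraph E \<Longrightarrow> finite (\<Union>E)"
  by (metis card.infinite finite_Union is_plgraph_def zero_neq_numeral)

lemma is_plgraph_subset: "is_plgraph E \<Longrightarrow> F \<subseteq> E \<Longrightarrow> is_plgraph F"
  by (auto simp: is_plgraph_def intro: finite_subset)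

lemma unlabeled_abs: "is_plgraph E \<Longrightarrow> unlabeled (abs_plgraph E) \<longleftrightarrow> (\<forall>n. Lab n \<notin> \<Union>E)"
  by (auto simp: unlabeled_def plgraph_abs_simps)

lemma num_edges_zero [simp]: "num_edges 0 = 0"
  using plgraph_abs_simps(4)[of "{}"] by (simp add: zero_plgraph_def)

lemma unlabel_zero [simp]: "unlabel 0 = 0"
  using plgraph_abs_simps(2)[of "{}"] by (simp add: zero_plgraph_def)

lemma inj_drop_label: "inj_on drop_label A"
  by (simp add: inj_on_def)

lemma Lab_notin_drop_label [simp]: "Lab n \<notin> drop_label ` A"
  by (metis drop_label_neq_Lab imageE)

lemma is_plgraph_drop_label: "is_plgraph E \<Longrightarrow> is_plgraph ((`) drop_label ` E)"
  by (rule is_plgraph_image[OF _ inj_drop_label]) simp_all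

lemma Union_image_image: "\<Union>((`) f ` E) = f ` \<Union>E"
  by blast

lemma unlabeled_unlabel [simp]: "unlabeled (unlabel G)"
proof (cases G)
  case (abs_plgraph E)
  then show ?thesis
    by (simp add: plgraph_abs_simps unlabeled_abs is_plgraph_drop_label Union_image_image
        del: Union_iff)
qed

lemma unlabel_unlabeled:
  assumes "unlabeled G"
  shows "unlabel G = G"
proof (cases G)
  case (abs_plgraph E)
  then have "plgraph_iso E ((`) drop_label ` E)"
    using assms inj_drop_label
    by (intro plgraph_isoI[where f = drop_label]) (auto simp: unlabeled_abs)
  then have "abs_plgraph E = abs_plgraph ((`) drop_label ` E)" by (rule abs_plgraph_eqI)
  also have "\<dots> = unlabel (abs_plgraph E)" using abs_plgraph(1) by (simp add: plgraph_abs_simps)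
  finally show ?thesis using abs_plgraph(2) by simp
qed

lemma unlabel_abs_image:
  assumes E: "is_plgraph E" and f: "inj_on f (\<Union>E)" "Lab 0 \<notin> f ` \<Union>E"
  shows "unlabel (abs_plgraph ((`) f ` E)) = unlabel (abs_plgraph E)"
proof -
  let ?g = "drop_label \<circ> f \<circ> inv drop_label"
  have "plgraph_iso ((`) drop_label ` E) ((`) drop_label ` (`) f ` E)"
  proof (rule plgraph_isoI[where f = ?g])
    show "is_plgraph ((`) drop_label ` E)" using E by (rule is_plgraph_drop_label)
    show "inj_on ?g (\<Union>((`) drop_label ` E))"
      unfolding Union_image_image using f(1) by (auto simp: inj_on_def inj_drop_label)
    show "?g x = Lab n \<longleftrightarrow> x = Lab n" if "x \<in> \<Union>((`) drop_label ` E)" for x n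
      using that unfolding Union_image_image by auto
    show "(`) drop_label ` (`) f ` E = (`) ?g ` (`) drop_label ` E"
      by (simp add: image_image inj_drop_label)
  qed
  then show ?thesis
    using E is_plgraph_image[OF E f] by (simp add: plgraph_abs_simps abs_plgraph_eqI)
qed

lemma num_edges_unlabel [simp]: "num_edges (unlabel G) = num_edges G"
proof (cases G)
  case (abs_plgraph E)
  have "inj_on ((`) drop_label) E" by (simp add: inj_on_def inj_image_eq_iff inj_drop_label)
  then show ?thesis
    using abs_plgraph by (simp add: plgraph_abs_simps is_plgraph_drop_label card_image)
qed

lemma num_edges_add: "num_edges (G + H) \<le> num_edges G + num_edges H"
proof (cases G, cases H)
  fix E F
  assume E: "is_plgraph E" "G = abs_plgraph E" and F: "is_plgraph F" "H = abs_plgraph F"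
  have "num_edges (G + H) = card (glue E F)"
    using E F by (simp add: plgraph_abs_simps is_plgraph_glue)
  also have "\<dots> \<le> card ((`) shiftL ` E) + card ((`) shiftR ` F)"
    unfolding glue_def by (rule card_Un_le)
  also have "\<dots> \<le> card E + card F"
    using E F by (intro add_mono card_image_le is_plgraph_finite)
  finally show ?thesis using E F by (simp add: plgraph_abs_simps)
qed

section \<open>Connected components\<close>

lemma equiv_adj_rtrancl: "equiv UNIV ((adj E)\<^sup>*)"
proof -
  have "sym (adj E)" by (auto simp: sym_def adj_def insert_commute)
  then show ?thesis by (simp add: equiv_def refl_rtrancl sym_rtrancl trans_rtrancl)
qed

lemma edge_components_altdef:
  "edge_components E = (\<lambda>u. {e \<in> E. e \<subseteq> (adj E)\<^sup>* `` {u}}) ` \<Union>E"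
  by (auto simp: edge_components_def quotient_def)

lemma edge_subset_class:
  assumes "is_plgraph E" "e \<in> E" "x \<in> e" "(u, x) \<in> (adj E)\<^sup>*"
  shows "e \<subseteq> (adj E)\<^sup>* `` {u}"
proof
  fix y assume "y \<in> e"
  moreover have "card e = 2" using assms(1,2) by (auto simp: is_plgraph_def)
  ultimately have "x = y \<or> e = {x, y}" using \<open>x \<in> e\<close> by (auto simp: card_2_iff)
  then have "(x, y) \<in> (adj E)\<^sup>*" using \<open>e \<in> E\<close> by (auto simp: adj_def)
  then show "y \<in> (adj E)\<^sup>* `` {u}" using assms(4) by (auto intro: rtrancl_trans)
qed

lemma edge_component_verts:
  assumes "is_plgraph E" "u \<in> \<Union>E"
  shows "\<Union>{e \<in> E. e \<subseteq> (adj E)\<^sup>* `` {u}} = (adj E)\<^sup>* `` {u}"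
proof
  show "(adj E)\<^sup>* `` {u} \<subseteq> \<Union>{e \<in> E. e \<subseteq> (adj E)\<^sup>* `` {u}}"
  proof
    fix x assume x: "x \<in> (adj E)\<^sup>* `` {u}"
    then obtain e where "e \<in> E" "x \<in> e" using assms(2) by (auto dest: adj_rtrancl_closed)
    then show "x \<in> \<Union>{e \<in> E. e \<subseteq> (adj E)\<^sup>* `` {u}}"
      using edge_subset_class[OF assms(1)] x by blast
  qed
qed auto

lemma edge_component_subset: "C \<in> edge_components E \<Longrightarrow> C \<subseteq> E"
  by (auto simp: edge_components_def)

lemma is_plgraph_edge_component: "is_plgraph E \<Longrightarrow> C \<in> edge_components E \<Longrightarrow> is_plgraph C"
  using edge_component_subset is_plgraph_subset by blast

lemma edge_component_nonempty:
  assumes "is_plgraph E" "C \<in> edge_components E"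
  shows "C \<noteq> {}"
proof -
  obtain u where u: "u \<in> \<Union>E" "C = {e \<in> E. e \<subseteq> (adj E)\<^sup>* `` {u}}"
    using assms(2) by (auto simp: edge_components_altdef)
  have "u \<in> \<Union>C" unfolding u(2) edge_component_verts[OF assms(1) u(1)] by simp
  then show ?thesis by blast
qed

lemma finite_edge_components: "is_plgraph E \<Longrightarrow> finite (edge_components E)"
  by (simp add: edge_components_altdef is_plgraph_finite_verts del: Union_iff)

lemma Union_edge_components:
  assumes "is_plgraph E"
  shows "\<Union>(edge_components E) = E"
proof
  show "E \<subseteq> \<Union>(edge_components E)"
  proof
    fix e assume e: "e \<in> E"
    then obtain u where "u \<in> e" using is_plgraph_edge_nonempty[OF assms] by blast
    then show "e \<in> \<Union>(edge_components E)"
      using e edge_subset_class[OF assms e, of u u] unfolding edge_components_altdef by auto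
  qed
qed (auto dest: edge_component_subset)

lemma edge_components_disjoint:
  assumes "C \<in> edge_components E" "C' \<in> edge_components E" "C \<noteq> C'"
  shows "\<Union>C \<inter> \<Union>C' = {}"
proof -
  obtain u u' where C: "C = {e \<in> E. e \<subseteq> (adj E)\<^sup>* `` {u}}" "C' = {e \<in> E. e \<subseteq> (adj E)\<^sup>* `` {u'}}"
    using assms(1,2) by (auto simp: edge_components_altdef)
  then have "(adj E)\<^sup>* `` {u} \<noteq> (adj E)\<^sup>* `` {u'}" using assms(3) by auto
  then have "(adj E)\<^sup>* `` {u} \<inter> (adj E)\<^sup>* `` {u'} = {}"
    using quotient_disj[OF equiv_adj_rtrancl, of "(adj E)\<^sup>* `` {u}" E "(adj E)\<^sup>* `` {u'}"]
    by (auto intro: quotientI)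
  then show ?thesis unfolding C by blast
qed

lemma connected_edge_component:
  assumes "is_plgraph E" "C \<in> edge_components E"
  shows "connected_graph (abs_plgraph C)"
proof -
  obtain u where u: "u \<in> \<Union>E" "C = {e \<in> E. e \<subseteq> (adj E)\<^sup>* `` {u}}"
    using assms(2) by (auto simp: edge_components_altdef)
  have path: "(u, x) \<in> (adj C)\<^sup>*" if "(u, x) \<in> (adj E)\<^sup>*" for x
    using that
  proof (induction rule: rtrancl_induct)
    case (step y z)
    then have "{y, z} \<in> E" "{y, z} \<subseteq> (adj E)\<^sup>* `` {u}"
      by (auto simp: adj_def intro: rtrancl_into_rtrancl)
    then have "(y, z) \<in> adj C" unfolding u by (simp add: adj_def)
    with step.IH show ?case by (rule rtrancl_into_rtrancl)
  qed simp
  have "(x, y) \<in> (adj C)\<^sup>*" if "x \<in> \<Union>C" "y \<in> \<Union>C" for x y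
  proof -
    have "(u, x) \<in> (adj C)\<^sup>*" "(u, y) \<in> (adj C)\<^sup>*"
      using that path unfolding u(2) edge_component_verts[OF assms(1) u(1)] by auto
    then show ?thesis using equiv_adj_rtrancl[of C] by (meson equivE symE transE)
  qed
  then show ?thesis using is_plgraph_edge_component[OF assms] by (simp add: plgraph_abs_simps)
qed

lemma adj_rtrancl_Un:
  assumes "\<Union>E \<inter> \<Union>F = {}" "u \<in> \<Union>E"
  shows "(adj (E \<union> F))\<^sup>* `` {u} = (adj E)\<^sup>* `` {u}"
proof -
  have "(u, x) \<in> (adj E)\<^sup>*" if "(u, x) \<in> (adj (E \<union> F))\<^sup>*" for x
    using that
  proof (induction rule: rtrancl_induct)
    case (step y z)
    then have "y \<in> \<Union>E" using adj_rtrancl_closed assms(2) by blast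
    then have "(y, z) \<in> adj E" using step.hyps assms(1) by (auto simp: adj_def)
    with step.IH show ?case by (rule rtrancl_into_rtrancl)
  qed simp
  moreover have "(adj E)\<^sup>* \<subseteq> (adj (E \<union> F))\<^sup>*" by (rule rtrancl_mono) (auto simp: adj_def)
  ultimately show ?thesis by blast
qed

lemma edge_component_Un:
  assumes "is_plgraph F" "\<Union>E \<inter> \<Union>F = {}" "u \<in> \<Union>E"
  shows "{e \<in> E \<union> F. e \<subseteq> (adj (E \<union> F))\<^sup>* `` {u}} = {e \<in> E. e \<subseteq> (adj E)\<^sup>* `` {u}}"
proof -
  have "(adj E)\<^sup>* `` {u} \<subseteq> \<Union>E" using assms(3) adj_rtrancl_closed by blast
  then have "\<not> e \<subseteq> (adj E)\<^sup>* `` {u}" if "e \<in> F" for e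
    using is_plgraph_edge_nonempty[OF assms(1) that] assms(2) that by blast
  then show ?thesis using adj_rtrancl_Un[OF assms(2,3)] by auto
qed

lemma edge_components_Un:
  assumes "is_plgraph E" "is_plgraph F" "\<Union>E \<inter> \<Union>F = {}"
  shows "edge_components (E \<union> F) = edge_components E \<union> edge_components F"
proof -
  have "{e \<in> E \<union> F. e \<subseteq> (adj (E \<union> F))\<^sup>* `` {u}} = {e \<in> F. e \<subseteq> (adj F)\<^sup>* `` {u}}"
    if "u \<in> \<Union>F" for u
    using edge_component_Un[of E F u] assms that by (simp add: Un_commute Int_commute)
  moreover have "{e \<in> E \<union> F. e \<subseteq> (adj (E \<union> F))\<^sup>* `` {u}} = {e \<in> E. e \<subseteq> (adj E)\<^sup>* `` {u}}"
    if "u \<in> \<Union>E" for u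
    using edge_component_Un assms that by blast
  ultimately show ?thesis
    unfolding edge_components_altdef Union_Un_distrib image_Un
    by (intro arg_cong2[where f = "(\<union>)"] image_cong) auto
qed

lemma set_components_abs:
  "is_plgraph E \<Longrightarrow> set_mset (components (abs_plgraph E)) = abs_plgraph ` edge_components E"
  by (simp add: plgraph_abs_simps finite_edge_components)

section \<open>Multiplicative graph parameters\<close>

text \<open>The map \<open>f\<close> below may change labels: a multiplicative parameter ignores them.\<close>

definition multiplicative :: "(vert set set \<Rightarrow> real) \<Rightarrow> bool" where
  "multiplicative g \<longleftrightarrow> g {} = 1 \<and>
    (\<forall>E F. is_plgraph E \<longrightarrow> is_plgraph F \<longrightarrow> \<Union>E \<inter> \<Union>F = {} \<longrightarrow> g (E \<union> F) = g E * g F) \<and>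
    (\<forall>E f. is_plgraph E \<longrightarrow> inj_on f (\<Union>E) \<longrightarrow> Lab 0 \<notin> f ` \<Union>E \<longrightarrow> g ((`) f ` E) = g E)"

lemma multiplicative_empty: "multiplicative g \<Longrightarrow> g {} = 1"
  and multiplicative_Un:
    "multiplicative g \<Longrightarrow> is_plgraph E \<Longrightarrow> is_plgraph F \<Longrightarrow> \<Union>E \<inter> \<Union>F = {} \<Longrightarrow> g (E \<union> F) = g E * g F"
  and multiplicative_image:
    "multiplicative g \<Longrightarrow> is_plgraph E \<Longrightarrow> inj_on f (\<Union>E) \<Longrightarrow> Lab 0 \<notin> f ` \<Union>E \<Longrightarrow> g ((`) f ` E) = g E"
  unfolding multiplicative_def by blast+

lemma multiplicative_iso:
  assumes "multiplicative g" "plgraph_iso E F"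
  shows "g E = g F"
  using assms(2)
proof (rule plgraph_isoE)
  fix f
  assume "is_plgraph E" "is_plgraph F" "inj_on f (\<Union>E)" "F = (`) f ` E"
  then show ?thesis
    using multiplicative_image[OF assms(1)] is_plgraph_Lab0[of F] by (simp add: Union_image_image)
qed

lemma multiplicative_rep_abs:
  "multiplicative g \<Longrightarrow> is_plgraph E \<Longrightarrow> g (rep_plgraph (abs_plgraph E)) = g E"
  using multiplicative_iso plgraph_iso_rep_abs by metis

lemma multiplicative_prod_components:
  assumes g: "multiplicative g" and E: "is_plgraph E"
  shows "g E = (\<Prod>C\<in>edge_components E. g C)"
proof -
  have "g (\<Union>\<C>) = (\<Prod>C\<in>\<C>. g C)" if "finite \<C>" "\<C> \<subseteq> edge_components E" for \<C>
    using that
  proof (induction rule: finite_induct)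
    case (insert C \<C>)
    have "\<Union>\<C> \<subseteq> E" "C \<subseteq> E" using insert.prems by (auto dest!: edge_component_subset)
    then have "is_plgraph (\<Union>\<C>)" "is_plgraph C" using is_plgraph_subset[OF E] by simp_all
    moreover have "\<Union>C \<inter> \<Union>C' = {}" if "C' \<in> \<C>" for C'
      using that insert.hyps(2) insert.prems by (intro edge_components_disjoint) auto
    then have "\<Union>C \<inter> \<Union>(\<Union>\<C>) = {}" by blast
    ultimately show ?case using insert multiplicative_Un[OF g, of C "\<Union>\<C>"] by simp
  qed (simp add: multiplicative_empty[OF g])
  then show ?thesis using finite_edge_components[OF E] Union_edge_components[OF E] by force
qed

lemma eval_graph_abs:
  "is_plgraph E \<Longrightarrow> eval_graph v (abs_plgraph E) = (\<Prod>C\<in>edge_components E. v (abs_plgraph C))"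
  by (simp add: eval_graph_def plgraph_abs_simps image_mset.compositionality o_def
      prod_unfold_prod_mset)

lemma eval_graph_Un:
  assumes "is_plgraph E" "is_plgraph F" "\<Union>E \<inter> \<Union>F = {}"
  shows "eval_graph v (abs_plgraph (E \<union> F))
    = eval_graph v (abs_plgraph E) * eval_graph v (abs_plgraph F)"
proof -
  have "E \<inter> F = {}" using assms is_plgraph_edge_nonempty by blast
  then have "edge_components E \<inter> edge_components F = {}"
    using assms(1) edge_component_nonempty edge_component_subset by blast
  then show ?thesis
    using assms
    by (simp add: eval_graph_abs is_plgraph_Un edge_components_Un prod.union_disjoint
        finite_edge_components)
qed

lemma eval_graph_zero [simp]: "eval_graph v 0 = 1"
  using eval_graph_abs[of "{}" v] by (simp add: zero_plgraph_def edge_components_altdef)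

lemma eval_graph_add:
  assumes "unlabeled G" "unlabeled H"
  shows "eval_graph v (G + H) = eval_graph v G * eval_graph v H"
proof (cases G, cases H)
  fix E F
  assume E: "is_plgraph E" "G = abs_plgraph E" and F: "is_plgraph F" "H = abs_plgraph F"
  let ?L = "(`) shiftL ` E" and ?R = "(`) shiftR ` F"
  have L: "plgraph_iso E ?L" by (rule plgraph_isoI[where f = shiftL]) (auto simp: inj_on_def E)
  have R: "plgraph_iso F ?R" by (rule plgraph_isoI[where f = shiftR]) (auto simp: inj_on_def F)
  have "\<Union>?L \<inter> \<Union>?R = {}"
    using assms E F by (auto simp: unlabeled_abs shiftL_eq_shiftR_iff)
  moreover have "is_plgraph ?L" "is_plgraph ?R" using L R by (auto simp: plgraph_iso_def)
  ultimately have "eval_graph v (abs_plgraph (glue E F))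
      = eval_graph v (abs_plgraph ?L) * eval_graph v (abs_plgraph ?R)"
    unfolding glue_def by (intro eval_graph_Un)
  then show ?thesis
    unfolding abs_plgraph_eqI[OF L, symmetric] abs_plgraph_eqI[OF R, symmetric]
    using E F by (simp add: plgraph_abs_simps)
qed

definition graph_density :: "(plgraph \<Rightarrow> real) \<Rightarrow> vert set set \<Rightarrow> real" where
  "graph_density v E = eval_graph v (unlabel (abs_plgraph E))"

lemma graph_density_unlabeled: "unlabeled G \<Longrightarrow> graph_density v (rep_plgraph G) = eval_graph v G"
  by (simp add: graph_density_def unlabel_unlabeled)

lemma multiplicative_graph_density: "multiplicative (graph_density v)"
  unfolding multiplicative_def
proof (intro conjI allI impI)
  show "graph_density v {} = 1" by (simp add: graph_density_def flip: zero_plgraph_def)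
next
  fix E F assume "is_plgraph E" "is_plgraph F" "\<Union>E \<inter> \<Union>F = {}"
  moreover from this(3) have "\<Union>((`) drop_label ` E) \<inter> \<Union>((`) drop_label ` F) = {}"
    unfolding Union_image_image by (simp add: image_Int[symmetric] inj_drop_label del: Union_iff)
  ultimately show "graph_density v (E \<union> F) = graph_density v E * graph_density v F"
    by (simp add: graph_density_def plgraph_abs_simps is_plgraph_Un image_Un eval_graph_Un
        is_plgraph_drop_label del: Union_iff)
next
  fix E f assume "is_plgraph E" "inj_on f (\<Union>E)" "Lab 0 \<notin> f ` \<Union>E"
  then show "graph_density v ((`) f ` E) = graph_density v E"
    by (simp add: graph_density_def unlabel_abs_image)
qed

lemma graph_density_multiplicative:
  assumes "multiplicative g" "is_plgraph E"
  shows "graph_density (g \<circ> rep_plgraph) E = g E"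
proof -
  let ?E = "(`) drop_label ` E"
  have E: "is_plgraph ?E" using assms(2) by (rule is_plgraph_drop_label)
  have "graph_density (g \<circ> rep_plgraph) E
      = (\<Prod>C\<in>edge_components ?E. g (rep_plgraph (abs_plgraph C)))"
    by (simp add: graph_density_def plgraph_abs_simps eval_graph_abs assms(2) E)
  also have "\<dots> = (\<Prod>C\<in>edge_components ?E. g C)"
    using E
    by (intro prod.cong) (auto simp: multiplicative_rep_abs assms(1) is_plgraph_edge_component)
  also have "\<dots> = g ?E" using multiplicative_prod_components[OF assms(1) E] by simp
  also have "\<dots> = g E" by (rule multiplicative_image[OF assms inj_drop_label]) simp
  finally show ?thesis .
qed

section \<open>Graph combinations\<close>

lemma sum_single_keys:
  "(\<Sum>G\<in>Poly_Mapping.keys a. Poly_Mapping.single G (Poly_Mapping.lookup a G)) = a"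
  by (rule poly_mapping_eqI)
    (auto simp: lookup_sum lookup_single when_def in_keys_iff sum.delta' if_distrib cong: if_cong)

lemma eval_comb_zero [simp]: "eval_comb v 0 = 0"
  by (simp add: eval_comb_def)

lemma eval_comb_single [simp]: "eval_comb v (Poly_Mapping.single G c) = c * eval_graph v G"
  by (simp add: eval_comb_def)

lemma eval_comb_add: "eval_comb v (a + b) = eval_comb v a + eval_comb v b"
  unfolding eval_comb_def by (rule setsum_keys_plus_distrib) (simp_all add: distrib_right)

lemma eval_comb_sum: "eval_comb v (\<Sum>i\<in>I. f i) = (\<Sum>i\<in>I. eval_comb v (f i))"
  by (induction I rule: infinite_finite_induct) (auto simp: eval_comb_add)

lemma eval_comb_sum_list: "eval_comb v (\<Sum>x\<leftarrow>xs. f x) = (\<Sum>x\<leftarrow>xs. eval_comb v (f x))"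
  by (induction xs) (auto simp: eval_comb_add)

lemma eval_comb_mult:
  assumes "unlabeled_comb a" "unlabeled_comb b"
  shows "eval_comb v (a * b) = eval_comb v a * eval_comb v b"
proof -
  let ?A = "Poly_Mapping.keys a" and ?B = "Poly_Mapping.keys b"
  let ?a = "Poly_Mapping.lookup a" and ?b = "Poly_Mapping.lookup b"
  have "eval_comb v (a * b) = eval_comb v
      ((\<Sum>G\<in>?A. Poly_Mapping.single G (?a G)) * (\<Sum>H\<in>?B. Poly_Mapping.single H (?b H)))"
    by (simp only: sum_single_keys)
  also have "\<dots> = (\<Sum>G\<in>?A. \<Sum>H\<in>?B. ?a G * ?b H * eval_graph v (G + H))"
    by (simp add: sum_product eval_comb_sum mult_single)
  also have "\<dots> = (\<Sum>G\<in>?A. \<Sum>H\<in>?B. (?a G * eval_graph v G) * (?b H * eval_graph v H))"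
    using assms by (intro sum.cong refl) (auto simp: unlabeled_comb_def eval_graph_add)
  also have "\<dots> = eval_comb v a * eval_comb v b"
    by (simp add: eval_comb_def sum_product)
  finally show ?thesis .
qed

lemma unlabel_comb_zero [simp]: "unlabel_comb 0 = 0"
  by (simp add: unlabel_comb_def)

lemma unlabel_comb_single [simp]:
  "unlabel_comb (Poly_Mapping.single G c) = Poly_Mapping.single (unlabel G) c"
  by (simp add: unlabel_comb_def)

lemma unlabel_comb_add: "unlabel_comb (a + b) = unlabel_comb a + unlabel_comb b"
  unfolding unlabel_comb_def by (rule setsum_keys_plus_distrib) (simp_all add: single_add)

lemma unlabel_comb_sum: "unlabel_comb (\<Sum>i\<in>I. f i) = (\<Sum>i\<in>I. unlabel_comb (f i))"
  by (induction I rule: infinite_finite_induct) (auto simp: unlabel_comb_add)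

lemma eval_comb_unlabel_sum_square:
  "eval_comb v (unlabel_comb ((\<Sum>i\<in>I. Poly_Mapping.single (g i) (c i))\<^sup>2))
    = (\<Sum>i\<in>I. \<Sum>j\<in>I. c i * c j * eval_graph v (unlabel (g i + g j)))"
  by (simp add: power2_eq_square sum_product mult_single unlabel_comb_sum eval_comb_sum)

lemma eval_comb_unlabel_square:
  "eval_comb v (unlabel_comb (p\<^sup>2)) = (\<Sum>A\<in>Poly_Mapping.keys p. \<Sum>B\<in>Poly_Mapping.keys p.
    Poly_Mapping.lookup p A * Poly_Mapping.lookup p B * eval_graph v (unlabel (A + B)))"
  using eval_comb_unlabel_sum_square[of v "\<lambda>G. G" "Poly_Mapping.lookup p" "Poly_Mapping.keys p"]
  by (simp add: sum_single_keys)

lemma keys_unlabel_square: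
  assumes "H \<in> Poly_Mapping.keys (unlabel_comb (a\<^sup>2))"
  obtains A B where "A \<in> Poly_Mapping.keys a" "B \<in> Poly_Mapping.keys a" "H = unlabel (A + B)"
proof -
  have "Poly_Mapping.keys (unlabel_comb (a\<^sup>2)) \<subseteq> (\<Union>G\<in>Poly_Mapping.keys (a\<^sup>2).
      Poly_Mapping.keys (Poly_Mapping.single (unlabel G) (Poly_Mapping.lookup (a\<^sup>2) G)))"
    unfolding unlabel_comb_def by (rule keys_sum)
  then obtain G where "G \<in> Poly_Mapping.keys (a * a)" "H = unlabel G"
    using assms by (auto simp: power2_eq_square split: if_splits)
  then show ?thesis using keys_mult[of a a] that by blast
qed

section \<open>The variables of the profile\<close>

fun label_vert :: "vert \<Rightarrow> vert" where
  "label_vert (Lab n) = Lab n"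
| "label_vert (Unl n) = Lab (Suc n)"

lemma glue_label_vert:
  "glue ((`) label_vert ` E) ((`) label_vert ` F) = (`) label_vert ` (E \<union> F)"
proof -
  have "shiftL (label_vert x) = label_vert x" "shiftR (label_vert x) = label_vert x" for x
    by (cases x; simp)+
  then show ?thesis by (simp add: glue_def image_image image_Un)
qed

lemma finite_card_halves:
  assumes "finite E" "card E \<le> 2 * d"
  obtains E1 E2 where "E = E1 \<union> E2" "card E1 \<le> d" "card E2 \<le> d"
proof -
  obtain E1 where E1: "E1 \<subseteq> E" "card E1 = min d (card E)"
    by (metis min.cobounded2 obtain_subset_with_card_n)
  have "card (E - E1) = card E - card E1"
    using E1 assms by (simp add: card_Diff_subset finite_subset)
  then show ?thesis using that[of E1 "E - E1"] E1 assms by (simp add: Un_absorb1)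
qed

lemma label_vert_unlabeled:
  assumes "\<And>n. Lab n \<notin> X"
  shows "inj_on label_vert X" "Lab 0 \<notin> label_vert ` X"
proof -
  have X: "\<exists>n. x = Unl n" if "x \<in> X" for x using that assms by (cases x) auto
  show "inj_on label_vert X"
  proof (rule inj_onI)
    fix x y assume "x \<in> X" "y \<in> X" "label_vert x = label_vert y"
    then show "x = y" using X[of x] X[of y] by auto
  qed
  show "Lab 0 \<notin> label_vert ` X" using X by fastforce
qed

lemma unlabeled_eq_unlabel_add:
  assumes "unlabeled C" "num_edges C \<le> 2 * d"
  obtains A B where "num_edges A \<le> d" "num_edges B \<le> d" "C = unlabel (A + B)"
proof (cases C)
  case (abs_plgraph E)
  then have no_label: "Lab n \<notin> \<Union>E" for n using assms(1) by (simp add: unlabeled_abs)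
  let ?lab = "\<lambda>E. (`) label_vert ` E"
  obtain E1 E2 where E: "E = E1 \<union> E2" and card: "card E1 \<le> d" "card E2 \<le> d"
    using finite_card_halves[of E d] assms(2) abs_plgraph
    by (auto simp: plgraph_abs_simps is_plgraph_finite)
  have half: "is_plgraph (?lab E')" "num_edges (abs_plgraph (?lab E')) \<le> card E'"
    if "E' \<subseteq> E" for E'
  proof -
    have E': "is_plgraph E'" using abs_plgraph(1) that by (rule is_plgraph_subset)
    show graph: "is_plgraph (?lab E')"
      using that no_label by (intro is_plgraph_image[OF E'] label_vert_unlabeled) auto
    show "num_edges (abs_plgraph (?lab E')) \<le> card E'"
      using card_image_le[OF is_plgraph_finite[OF E']] by (simp add: plgraph_abs_simps graph)
  qed
  have "unlabel (abs_plgraph (?lab E1) + abs_plgraph (?lab E2)) = unlabel (abs_plgraph (?lab E))"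
    using half(1)[of E1] half(1)[of E2] E by (simp add: plgraph_abs_simps(1) glue_label_vert)
  also have "\<dots> = C"
    using unlabel_abs_image[OF abs_plgraph(1) label_vert_unlabeled[OF no_label]]
    by (simp add: unlabel_unlabeled assms(1) flip: abs_plgraph(2))
  finally show ?thesis
    using that half(2)[of E1] half(2)[of E2] E card by (metis le_trans sup_ge1 sup_ge2)
qed

lemma keys_sum_list:
  assumes "x \<in> Poly_Mapping.keys (\<Sum>i\<leftarrow>is. f i)"
  obtains i where "i \<in> set is" "x \<in> Poly_Mapping.keys (f i)"
  using assms
proof (induction "is" arbitrary: thesis)
  case (Cons i "is")
  then consider "x \<in> Poly_Mapping.keys (f i)" | "x \<in> Poly_Mapping.keys (\<Sum>i\<leftarrow>is. f i)"
    using keys_add[of "f i" "\<Sum>i\<leftarrow>is. f i"] by auto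
  then show ?case using Cons by cases auto
qed simp

lemma is_sos_unlabel_square:
  "(\<And>G. G \<in> Poly_Mapping.keys p \<Longrightarrow> num_edges G \<le> d) \<Longrightarrow> is_sos d (unlabel_comb (p\<^sup>2))"
  unfolding is_sos_def by (intro exI[of _ "[p]"]) auto

lemma unlabel_add_in_sos:
  assumes "num_edges A \<le> d" "num_edges B \<le> d"
  obtains s where "is_sos d s" "unlabel (A + B) \<in> Poly_Mapping.keys s"
proof
  let ?p = "Poly_Mapping.single A 1 + Poly_Mapping.single B 1 :: graph_comb"
  have "Poly_Mapping.keys ?p \<subseteq> {A, B}" using keys_add by fastforce
  then show "is_sos d (unlabel_comb (?p\<^sup>2))" using assms by (intro is_sos_unlabel_square) auto
  have "unlabel_comb (?p\<^sup>2) =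
      Poly_Mapping.single (unlabel (A + A)) 1 + Poly_Mapping.single (unlabel (A + B)) 1
      + (Poly_Mapping.single (unlabel (A + B)) 1 + Poly_Mapping.single (unlabel (B + B)) 1)"
    by (simp only: power2_eq_square distrib_left distrib_right mult_single unlabel_comb_add
        unlabel_comb_single add.commute[of B A] mult_1)
  then have "Poly_Mapping.lookup (unlabel_comb (?p\<^sup>2)) (unlabel (A + B)) > 0"
    by (simp only: lookup_add lookup_single) (simp add: when_def)
  then show "unlabel (A + B) \<in> Poly_Mapping.keys (unlabel_comb (?p\<^sup>2))" by (simp add: in_keys_iff)
qed

text \<open>
  The graph occurs in the \<open>d\<close>-sos combination \<open>[[(A + B)\<^sup>2]]\<close>, hence also in a way of writing that
  combination with labels at most \<open>l d\<close>.
\<close>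

lemma unlabel_add_few_labels:
  assumes l: "label_bound l" and "num_edges A \<le> d" "num_edges B \<le> d"
  obtains A' B' where "A' \<in> \<B> l d" "B' \<in> \<B> l d" "unlabel (A + B) = unlabel (A' + B')"
proof -
  obtain s where s: "is_sos d s" "unlabel (A + B) \<in> Poly_Mapping.keys s"
    using unlabel_add_in_sos assms(2,3) .
  then have "is_sos_labels (l d) d s" using l by (simp add: label_bound_def)
  then obtain as where
    as: "\<And>a G. a \<in> set as \<Longrightarrow> G \<in> Poly_Mapping.keys a \<Longrightarrow> num_edges G \<le> d \<and> labels G \<subseteq> {1..l d}"
    and sum: "s = (\<Sum>a\<leftarrow>as. unlabel_comb (a\<^sup>2))"
    unfolding is_sos_labels_def by blast
  obtain a where a: "a \<in> set as" "unlabel (A + B) \<in> Poly_Mapping.keys (unlabel_comb (a\<^sup>2))"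
    using s(2) unfolding sum by (rule keys_sum_list)
  obtain A' B' where "A' \<in> Poly_Mapping.keys a" "B' \<in> Poly_Mapping.keys a"
    "unlabel (A + B) = unlabel (A' + B')"
    using a(2) by (rule keys_unlabel_square)
  then show ?thesis using that as[OF a(1)] by (auto simp: \<B>_def)
qed

lemma \<V>_eq:
  assumes "label_bound l"
  shows "\<V> l d = {C. unlabeled C \<and> connected_graph C \<and> num_edges C \<le> 2 * d \<and> C \<noteq> 0}"
proof (intro equalityI subsetI)
  fix C assume "C \<in> \<V> l d"
  then obtain A B where C: "C \<noteq> 0" "C = unlabel (A + B)" "A \<in> \<B> l d" "B \<in> \<B> l d" "connected_graph C"
    by (auto simp: \<V>_def)
  moreover have "num_edges C \<le> 2 * d" using num_edges_add[of A B] C by (simp add: \<B>_def)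
  ultimately show "C \<in> {C. unlabeled C \<and> connected_graph C \<and> num_edges C \<le> 2 * d \<and> C \<noteq> 0}"
    by simp
next
  fix C assume "C \<in> {C. unlabeled C \<and> connected_graph C \<and> num_edges C \<le> 2 * d \<and> C \<noteq> 0}"
  then have C: "unlabeled C" "connected_graph C" "num_edges C \<le> 2 * d" "C \<noteq> 0" by auto
  obtain A B where "num_edges A \<le> d" "num_edges B \<le> d" "C = unlabel (A + B)"
    using unlabeled_eq_unlabel_add C(1,3) .
  with assms obtain A' B' where "A' \<in> \<B> l d" "B' \<in> \<B> l d" "C = unlabel (A' + B')"
    using unlabel_add_few_labels by metis
  then show "C \<in> \<V> l d" using C unfolding \<V>_def by blast
qed

lemma \<V>_mono: "label_bound l \<Longrightarrow> d \<le> d' \<Longrightarrow> \<V> l d \<subseteq> \<V> l d'"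
  by (auto simp: \<V>_eq)

lemma components_subset_\<V>:
  assumes l: "label_bound l" and "unlabeled G" "num_edges G \<le> 2 * d"
  shows "set_mset (components G) \<subseteq> \<V> l d"
proof (cases G)
  case (abs_plgraph E)
  have "abs_plgraph C \<in> \<V> l d" if C: "C \<in> edge_components E" for C
  proof -
    have sub: "C \<subseteq> E" and graph: "is_plgraph C"
      using C abs_plgraph(1) by (auto dest: edge_component_subset is_plgraph_edge_component)
    have "card C \<le> 2 * d"
      using card_mono[OF is_plgraph_finite sub] assms(3) abs_plgraph
      by (simp add: plgraph_abs_simps)
    moreover have "num_edges (abs_plgraph C) \<noteq> 0"
      using edge_component_nonempty[OF abs_plgraph(1) C] graph
      by (simp add: plgraph_abs_simps is_plgraph_finite)
    then have "abs_plgraph C \<noteq> 0" by fastforce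
    moreover have "unlabeled (abs_plgraph C)"
      using assms(2) sub graph abs_plgraph by (auto simp: unlabeled_abs)
    moreover have "connected_graph (abs_plgraph C)"
      by (rule connected_edge_component[OF abs_plgraph(1) C])
    ultimately show ?thesis using graph by (simp add: \<V>_eq[OF l] plgraph_abs_simps)
  qed
  then show ?thesis using abs_plgraph by (auto simp: set_components_abs)
qed

section \<open>Sos profiles\<close>

definition components_in :: "plgraph set \<Rightarrow> graph_comb \<Rightarrow> bool" where
  "components_in X a \<longleftrightarrow> (\<forall>G\<in>Poly_Mapping.keys a. set_mset (components G) \<subseteq> X)"

lemma components_in_mono: "components_in X a \<Longrightarrow> X \<subseteq> Y \<Longrightarrow> components_in Y a"
  unfolding components_in_def by blast

lemma eval_comb_restrict: "components_in X a \<Longrightarrow> eval_comb (restrict v X) a = eval_comb v a"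
  unfolding eval_comb_def eval_graph_def components_in_def
  by (intro sum.cong refl arg_cong2[where f = "(*)"] arg_cong[where f = prod_mset]
      image_mset_cong) auto

lemma ex_components_in_\<V>:
  assumes "label_bound l" "unlabeled_comb a"
  shows "\<exists>d. components_in (\<V> l d) a"
proof
  let ?d = "\<Sum>G\<in>Poly_Mapping.keys a. num_edges G"
  have "num_edges G \<le> 2 * ?d" if "G \<in> Poly_Mapping.keys a" for G
    using member_le_sum[OF that, of num_edges] by simp
  then show "components_in (\<V> l ?d) a"
    using assms(2) components_subset_\<V>[OF assms(1)]
    by (simp add: components_in_def unlabeled_comb_def)
qed

lemma components_in_unlabel_square:
  assumes "label_bound l" "\<And>G. G \<in> Poly_Mapping.keys p \<Longrightarrow> num_edges G \<le> d"
  shows "components_in (\<V> l d) (unlabel_comb (p\<^sup>2))"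
  unfolding components_in_def
proof
  fix H assume "H \<in> Poly_Mapping.keys (unlabel_comb (p\<^sup>2))"
  then obtain A B where "A \<in> Poly_Mapping.keys p" "B \<in> Poly_Mapping.keys p" "H = unlabel (A + B)"
    by (rule keys_unlabel_square)
  moreover from this have "num_edges H \<le> 2 * d"
    using num_edges_add[of A B] assms(2)[of A] assms(2)[of B] by simp
  ultimately show "set_mset (components H) \<subseteq> \<V> l d" using components_subset_\<V>[OF assms(1)] by simp
qed

definition sos_positive :: "nat \<Rightarrow> (plgraph \<Rightarrow> real) \<Rightarrow> bool" where
  "sos_positive d v \<longleftrightarrow>
    (\<forall>p. (\<forall>G\<in>Poly_Mapping.keys p. num_edges G \<le> d) \<longrightarrow> eval_comb v (unlabel_comb (p\<^sup>2)) \<ge> 0)"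

lemma sos_positive_mono: "sos_positive d' v \<Longrightarrow> d \<le> d' \<Longrightarrow> sos_positive d v"
  unfolding sos_positive_def by (meson le_trans)

lemma sos_profile_iff: "v \<in> sos_profile l d \<longleftrightarrow> v \<in> \<V> l d \<rightarrow>\<^sub>E {0..} \<and> sos_positive d v"
proof -
  have "(\<forall>a. is_sos d a \<longrightarrow> eval_comb v a \<ge> 0) \<longleftrightarrow> sos_positive d v"
  proof
    assume "\<forall>a. is_sos d a \<longrightarrow> eval_comb v a \<ge> 0"
    then show "sos_positive d v" by (auto simp: sos_positive_def intro: is_sos_unlabel_square)
  next
    assume "sos_positive d v"
    then show "\<forall>a. is_sos d a \<longrightarrow> eval_comb v a \<ge> 0"
      by (auto simp: sos_positive_def is_sos_def eval_comb_sum_list intro!: sum_list_nonneg)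
  qed
  then show ?thesis by (simp add: sos_profile_def)
qed

lemma restrict_in_sos_profile:
  assumes l: "label_bound l" and v: "sos_positive d v" "\<And>C. C \<in> \<V> l d \<Longrightarrow> v C \<ge> 0"
  shows "restrict v (\<V> l d) \<in> sos_profile l d"
proof -
  have "sos_positive d (restrict v (\<V> l d))"
    using v(1) components_in_unlabel_square[OF l] unfolding sos_positive_def
    by (simp add: eval_comb_restrict)
  then show ?thesis using v(2) by (auto simp: sos_profile_iff)
qed

lemma sos_profile_graph_density_nonneg:
  assumes l: "label_bound l" and v: "v \<in> sos_profile l d" and E: "is_plgraph E" "card E \<le> 2 * d"
  shows "graph_density v E \<ge> 0"
proof -
  have "set_mset (components (unlabel (abs_plgraph E))) \<subseteq> \<V> l d"
    using E by (intro components_subset_\<V>[OF l]) (simp_all add: plgraph_abs_simps(4))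
  then have "\<forall>C\<in>#components (unlabel (abs_plgraph E)). v C \<ge> 0"
    using v by (auto simp: sos_profile_def)
  moreover have "(\<forall>C\<in>#M. v C \<ge> 0) \<longrightarrow> prod_mset (image_mset v M) \<ge> 0" for M
    by (induction M) auto
  ultimately show ?thesis by (simp add: graph_density_def eval_graph_def)
qed

definition sos_testable_at :: "(nat \<Rightarrow> nat) \<Rightarrow> nat \<Rightarrow> graph_comb \<Rightarrow> bool" where
  "sos_testable_at l d a \<longleftrightarrow> components_in (\<V> l d) a \<and> (\<forall>v\<in>sos_profile l d. eval_comb v a \<ge> 0)"

lemma sos_testable_iff: "sos_testable l a \<longleftrightarrow> unlabeled_comb a \<and> (\<exists>d. sos_testable_at l d a)"
  by (simp add: sos_testable_def sos_testable_at_def components_in_def)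

lemma sos_testable_at_mono:
  assumes l: "label_bound l" and a: "sos_testable_at l d a" and "d \<le> d'"
  shows "sos_testable_at l d' a"
  unfolding sos_testable_at_def
proof (intro conjI ballI)
  have sub: "\<V> l d \<subseteq> \<V> l d'" using l \<open>d \<le> d'\<close> by (rule \<V>_mono)
  then show "components_in (\<V> l d') a"
    using a components_in_mono by (auto simp: sos_testable_at_def)
  fix v assume v: "v \<in> sos_profile l d'"
  have "restrict v (\<V> l d) \<in> sos_profile l d"
  proof (rule restrict_in_sos_profile[OF l])
    show "sos_positive d v" using v \<open>d \<le> d'\<close> sos_positive_mono by (auto simp: sos_profile_iff)
    show "v C \<ge> 0" if "C \<in> \<V> l d" for C using that v sub by (auto simp: sos_profile_def)
  qed
  then have "eval_comb (restrict v (\<V> l d)) a \<ge> 0" using a by (simp add: sos_testable_at_def)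
  then show "eval_comb v a \<ge> 0" using a eval_comb_restrict by (simp add: sos_testable_at_def)
qed

section \<open>Random maps\<close>

lemma expectation_bind_pmf:
  fixes h :: "'b \<Rightarrow> real"
  assumes "finite (set_pmf p)" "\<And>x. x \<in> set_pmf p \<Longrightarrow> finite (set_pmf (f x))"
  shows "measure_pmf.expectation (bind_pmf p f) h
    = measure_pmf.expectation p (\<lambda>x. measure_pmf.expectation (f x) h)"
  using assms
  by (simp add: pmf_expectation_bind[of "set_pmf p"] integral_measure_pmf[of "set_pmf p" p])

lemma expectation_pair_pmf_mult:
  fixes f :: "'a \<Rightarrow> real" and g :: "'b \<Rightarrow> real"
  assumes "finite (set_pmf p)" "finite (set_pmf q)"
  shows "measure_pmf.expectation (pair_pmf p q) (\<lambda>z. f (fst z) * g (snd z))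
    = measure_pmf.expectation p f * measure_pmf.expectation q g"
  unfolding pair_pmf_def using assms by (simp add: expectation_bind_pmf)

lemma finite_set_Pi_pmf:
  "finite A \<Longrightarrow> finite (set_pmf q) \<Longrightarrow> finite (set_pmf (Pi_pmf A d (\<lambda>_. q)))"
  by (simp add: set_Pi_pmf finite_PiE_dflt)

lemma expectation_Pi_pmf_subset:
  fixes g :: "('a \<Rightarrow> 'b) \<Rightarrow> real"
  assumes "finite T" "S \<subseteq> T" and "\<And>\<phi> \<phi>'. (\<And>x. x \<in> S \<Longrightarrow> \<phi> x = \<phi>' x) \<Longrightarrow> g \<phi> = g \<phi>'"
  shows "measure_pmf.expectation (Pi_pmf S d q) g = measure_pmf.expectation (Pi_pmf T d q) g"
proof -
  have "g (\<lambda>x. if x \<in> S then \<phi> x else d) = g \<phi>" for \<phi> by (rule assms(3)) simp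
  then show ?thesis by (simp add: Pi_pmf_subset[OF assms(1,2)])
qed

lemma expectation_Pi_pmf_image:
  fixes g :: "('a \<Rightarrow> 'b) \<Rightarrow> real"
  assumes S: "finite S" and f: "inj_on f S" "f ` S \<noteq> UNIV"
    and g: "\<And>\<phi> \<phi>'. (\<And>x. x \<in> S \<Longrightarrow> \<phi> x = \<phi>' x) \<Longrightarrow> g \<phi> = g \<phi>'"
  shows "measure_pmf.expectation (Pi_pmf (f ` S) d (\<lambda>_. q)) (\<lambda>\<phi>. g (\<phi> \<circ> f))
    = measure_pmf.expectation (Pi_pmf S d (\<lambda>_. q)) g"
proof -
  obtain y where y: "y \<notin> f ` S" using f(2) by blast
  let ?h = "\<lambda>x. if x \<in> S then f x else y"
  have bij: "bij_betw ?h S (f ` S)" using f(1) by (simp add: bij_betw_def inj_on_def)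
  have "Pi_pmf S d (\<lambda>_. q) = map_pmf (\<lambda>\<phi>. \<phi> \<circ> ?h) (Pi_pmf (f ` S) d (\<lambda>_. q))"
    by (rule Pi_pmf_bij_betw[OF S bij]) (simp add: y)
  moreover have "g (\<phi> \<circ> ?h) = g (\<phi> \<circ> f)" for \<phi> by (rule g) simp
  ultimately show ?thesis by simp
qed

text \<open>
  Conditioned on the images of the labeled vertices \<open>L\<close>, a random map on the vertices of a product
  maps the unlabeled vertices of the two factors independently.
\<close>

lemma Pi_pmf_shift:
  assumes "finite L" "L \<subseteq> range Lab" "finite M" "M \<subseteq> range Unl"
  shows "map_pmf (\<lambda>\<eta>. (\<eta> \<circ> shiftL, \<eta> \<circ> shiftR)) (Pi_pmf (L \<union> (shiftL ` M \<union> shiftR ` M)) d (\<lambda>_. q)) =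
    Pi_pmf L d (\<lambda>_. q) \<bind> (\<lambda>\<psi>. Pi_pmf M d (\<lambda>_. q) \<bind> (\<lambda>\<phi>. Pi_pmf M d (\<lambda>_. q) \<bind> (\<lambda>\<phi>'.
      return_pmf (override_on \<phi> \<psi> L, override_on \<phi>' \<psi> L))))"
proof -
  let ?P = "\<lambda>A. Pi_pmf A d (\<lambda>_. q)"
  let ?j = "\<lambda>\<psi> \<alpha> \<beta> x. if x \<in> L then \<psi> x else if x \<in> shiftL ` M then \<alpha> x else \<beta> x"
  obtain X Y where LM: "L = Lab ` X" "M = Unl ` Y" using assms(2,4) by (auto simp: subset_image_iff)
  have disjoint: "L \<inter> (shiftL ` M \<union> shiftR ` M) = {}" "shiftL ` M \<inter> shiftR ` M = {}"
    by (auto simp: LM, presburger)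
  have shift_mem: "x \<in> L \<Longrightarrow> shiftL x = x" "x \<in> L \<Longrightarrow> shiftR x = x"
    "shiftL x \<in> L \<longleftrightarrow> x \<in> L" "shiftR x \<in> L \<longleftrightarrow> x \<in> L"
    "shiftL x \<in> shiftR ` M \<longleftrightarrow> False" "shiftR x \<in> shiftL ` M \<longleftrightarrow> False" for x
    by (cases x; auto simp: LM image_iff; presburger)+
  have half: "?P M = map_pmf (\<lambda>\<alpha>. \<alpha> \<circ> shiftL) (?P (shiftL ` M))"
    "?P M = map_pmf (\<lambda>\<beta>. \<beta> \<circ> shiftR) (?P (shiftR ` M))"
    using assms(3) by (intro Pi_pmf_bij_betw; force simp: bij_betw_def inj_on_def)+
  have "map_pmf (\<lambda>\<eta>. (\<eta> \<circ> shiftL, \<eta> \<circ> shiftR)) (?P (L \<union> (shiftL ` M \<union> shiftR ` M))) =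
    ?P L \<bind> (\<lambda>\<psi>. ?P (shiftL ` M) \<bind> (\<lambda>\<alpha>. ?P (shiftR ` M) \<bind> (\<lambda>\<beta>.
      return_pmf (?j \<psi> \<alpha> \<beta> \<circ> shiftL, ?j \<psi> \<alpha> \<beta> \<circ> shiftR))))"
    using assms(1,3) disjoint
    by (simp add: Pi_pmf_union pair_pmf_def map_bind_pmf bind_map_pmf bind_assoc_pmf
        bind_return_pmf)
  also have "\<dots> = ?P L \<bind> (\<lambda>\<psi>. ?P (shiftL ` M) \<bind> (\<lambda>\<alpha>. ?P (shiftR ` M) \<bind> (\<lambda>\<beta>.
      return_pmf (override_on (\<alpha> \<circ> shiftL) \<psi> L, override_on (\<beta> \<circ> shiftR) \<psi> L))))"
  proof (intro bind_pmf_cong refl arg_cong[where f = return_pmf] arg_cong2[where f = Pair])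
    fix \<psi> \<alpha> \<beta>
    assume "\<alpha> \<in> set_pmf (?P (shiftL ` M))" "\<beta> \<in> set_pmf (?P (shiftR ` M))"
    then have default: "x \<notin> shiftL ` M \<Longrightarrow> \<alpha> x = d" "x \<notin> shiftR ` M \<Longrightarrow> \<beta> x = d" for x
      using assms(3) by (auto simp: set_Pi_pmf PiE_dflt_def)
    show "?j \<psi> \<alpha> \<beta> \<circ> shiftL = override_on (\<alpha> \<circ> shiftL) \<psi> L"
      "?j \<psi> \<alpha> \<beta> \<circ> shiftR = override_on (\<beta> \<circ> shiftR) \<psi> L"
      using default shift_mem by (auto simp: fun_eq_iff override_on_def)
  qed
  also have "\<dots> = ?P L \<bind> (\<lambda>\<psi>. map_pmf (\<lambda>\<alpha>. \<alpha> \<circ> shiftL) (?P (shiftL ` M)) \<bind>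
      (\<lambda>\<phi>. map_pmf (\<lambda>\<beta>. \<beta> \<circ> shiftR) (?P (shiftR ` M)) \<bind> (\<lambda>\<phi>'.
      return_pmf (override_on \<phi> \<psi> L, override_on \<phi>' \<psi> L))))"
    by (simp add: bind_map_pmf)
  finally show ?thesis unfolding half[symmetric] .
qed

section \<open>Blending a profile with a weighted graph\<close>

text \<open>
  Think of \<open>v\<close> as the densities of a graphon. A random map sends a vertex either into the graphon
  (\<open>None\<close>) or to a vertex of the graph with edge set \<open>F\<close>, with probabilities \<open>q\<close>; there are no edges
  between the two. Hence \<open>blend v q F\<close> gives the densities of their disjoint union.
\<close>

definition none_edges :: "('a \<Rightarrow> 'u option) \<Rightarrow> 'a set set \<Rightarrow> 'a set set" where
  "none_edges \<phi> E = {e \<in> E. \<phi> ` e = {None}}"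

definition edges_respected :: "'u set set \<Rightarrow> ('a \<Rightarrow> 'u option) \<Rightarrow> 'a set set \<Rightarrow> bool" where
  "edges_respected F \<phi> E \<longleftrightarrow> (\<forall>e\<in>E. \<phi> ` e = {None} \<or> \<phi> ` e \<in> (`) Some ` F)"

definition map_density ::
  "(plgraph \<Rightarrow> real) \<Rightarrow> 'u set set \<Rightarrow> (vert \<Rightarrow> 'u option) \<Rightarrow> vert set set \<Rightarrow> real" where
  "map_density v F \<phi> E = of_bool (edges_respected F \<phi> E) * graph_density v (none_edges \<phi> E)"

definition blend :: "(plgraph \<Rightarrow> real) \<Rightarrow> 'u option pmf \<Rightarrow> 'u set set \<Rightarrow> vert set set \<Rightarrow> real" where
  "blend v q F E = measure_pmf.expectation (Pi_pmf (\<Union>E) None (\<lambda>_. q)) (\<lambda>\<phi>. map_density v F \<phi> E)"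

lemma none_edges_subset: "none_edges \<phi> E \<subseteq> E"
  by (auto simp: none_edges_def)

lemma none_edges_Un: "none_edges \<phi> (E \<union> E') = none_edges \<phi> E \<union> none_edges \<phi> E'"
  by (auto simp: none_edges_def)

lemma none_edges_image: "none_edges \<phi> ((`) f ` E) = (`) f ` none_edges (\<phi> \<circ> f) E"
  by (auto simp: none_edges_def image_comp)

lemma is_plgraph_none_edges: "is_plgraph E \<Longrightarrow> is_plgraph (none_edges \<phi> E)"
  by (erule is_plgraph_subset) (rule none_edges_subset)

lemma edges_respected_Un:
  "edges_respected F \<phi> (E \<union> E') \<longleftrightarrow> edges_respected F \<phi> E \<and> edges_respected F \<phi> E'"
  by (auto simp: edges_respected_def)

lemma edges_respected_image: "edges_respected F \<phi> ((`) f ` E) \<longleftrightarrow> edges_respected F (\<phi> \<circ> f) E"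
  by (simp add: edges_respected_def image_comp)

lemma
  assumes "\<And>x. x \<in> \<Union>E \<Longrightarrow> \<phi> x = \<phi>' x"
  shows none_edges_cong: "none_edges \<phi> E = none_edges \<phi>' E"
    and edges_respected_cong: "edges_respected F \<phi> E = edges_respected F \<phi>' E"
proof -
  have "\<phi> ` e = \<phi>' ` e" if "e \<in> E" for e using that assms by (intro image_cong) auto
  then show "none_edges \<phi> E = none_edges \<phi>' E" "edges_respected F \<phi> E = edges_respected F \<phi>' E"
    by (auto simp: none_edges_def edges_respected_def)
qed

lemma map_density_cong:
  "(\<And>x. x \<in> \<Union>E \<Longrightarrow> \<phi> x = \<phi>' x) \<Longrightarrow> map_density v F \<phi> E = map_density v F \<phi>' E"
  using none_edges_cong[of E \<phi> \<phi>'] edges_respected_cong[of E \<phi> \<phi>' F] by (simp add: map_density_def)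

lemma map_density_image:
  assumes "is_plgraph E" "inj_on f (\<Union>E)" "Lab 0 \<notin> f ` \<Union>E"
  shows "map_density v F \<phi> ((`) f ` E) = map_density v F (\<phi> \<circ> f) E"
proof -
  have "\<Union>(none_edges (\<phi> \<circ> f) E) \<subseteq> \<Union>E" by (intro Union_mono none_edges_subset)
  then have "graph_density v ((`) f ` none_edges (\<phi> \<circ> f) E)
      = graph_density v (none_edges (\<phi> \<circ> f) E)"
    using assms
    by (intro multiplicative_image[OF multiplicative_graph_density] is_plgraph_none_edges)
      (auto intro: inj_on_subset simp del: Union_iff)
  then show ?thesis by (simp add: map_density_def none_edges_image edges_respected_image)
qed

lemma map_density_Un:
  assumes "is_plgraph E" "is_plgraph E'" "\<Union>E \<inter> \<Union>E' = {}"
  shows "map_density v F \<phi> (E \<union> E') = map_density v F \<phi> E * map_density v F \<phi> E'"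
proof -
  have "\<Union>(none_edges \<phi> E) \<inter> \<Union>(none_edges \<phi> E') = {}"
    using assms(3) none_edges_subset[of \<phi> E] none_edges_subset[of \<phi> E'] by blast
  then have "graph_density v (none_edges \<phi> E \<union> none_edges \<phi> E')
      = graph_density v (none_edges \<phi> E) * graph_density v (none_edges \<phi> E')"
    using assms by (intro multiplicative_Un[OF multiplicative_graph_density] is_plgraph_none_edges)
  then show ?thesis by (simp add: map_density_def none_edges_Un edges_respected_Un)
qed

lemma blend_superset:
  assumes "finite V" "\<Union>E \<subseteq> V"
  shows "blend v q F E = measure_pmf.expectation (Pi_pmf V None (\<lambda>_. q)) (\<lambda>\<phi>. map_density v F \<phi> E)"
  unfolding blend_def using assms by (rule expectation_Pi_pmf_subset) (rule map_density_cong)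

lemma blend_image:
  assumes "is_plgraph E" "inj_on f (\<Union>E)" "Lab 0 \<notin> f ` \<Union>E"
  shows "blend v q F ((`) f ` E) = blend v q F E"
proof -
  have "blend v q F ((`) f ` E) = measure_pmf.expectation (Pi_pmf (f ` \<Union>E) None (\<lambda>_. q))
      (\<lambda>\<phi>. map_density v F (\<phi> \<circ> f) E)"
    unfolding blend_def Union_image_image map_density_image[OF assms] ..
  also have "\<dots> = blend v q F E"
    unfolding blend_def using assms
    by (intro expectation_Pi_pmf_image is_plgraph_finite_verts map_density_cong) auto
  finally show ?thesis .
qed

lemma blend_Un:
  assumes q: "finite (set_pmf q)" and E: "is_plgraph E" "is_plgraph E'" "\<Union>E \<inter> \<Union>E' = {}"
  shows "blend v q F (E \<union> E') = blend v q F E * blend v q F E'"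
proof -
  let ?P = "\<lambda>E. Pi_pmf (\<Union>E) None (\<lambda>_. q)"
  have fin: "finite (\<Union>E)" "finite (\<Union>E')" using E by (simp_all only: is_plgraph_finite_verts)
  have map_density_split: "map_density v F (\<lambda>x. if x \<in> \<Union>E then \<phi> x else \<psi> x) (E \<union> E')
      = map_density v F \<phi> E * map_density v F \<psi> E'" for \<phi> \<psi>
    unfolding map_density_Un[OF E]
    by (intro arg_cong2[where f = "(*)"] map_density_cong) (use E(3) in auto)
  have "blend v q F (E \<union> E') = measure_pmf.expectation (pair_pmf (?P E) (?P E'))
      (\<lambda>z. map_density v F (fst z) E * map_density v F (snd z) E')"
    using fin E(3)
    by (simp add: blend_def Pi_pmf_union case_prod_unfold map_density_split del: Union_iff)
  also have "\<dots> = blend v q F E * blend v q F E'"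
    unfolding blend_def using fin q by (intro expectation_pair_pmf_mult finite_set_Pi_pmf)
  finally show ?thesis .
qed

lemma map_density_empty: "map_density v F \<phi> {} = 1"
  by (simp add: map_density_def none_edges_def edges_respected_def multiplicative_empty
      multiplicative_graph_density)

lemma multiplicative_blend: "finite (set_pmf q) \<Longrightarrow> multiplicative (blend v q F)"
  unfolding multiplicative_def
  by (auto simp: blend_Un blend_image simp del: Union_iff) (simp add: blend_def map_density_empty)

section \<open>Blends are sos-positive\<close>

definition pair_density :: "(plgraph \<Rightarrow> real) \<Rightarrow> 'u set set \<Rightarrow> vert set set \<Rightarrow> vert set set \<Rightarrow>
    (vert \<Rightarrow> 'u option) \<Rightarrow> (vert \<Rightarrow> 'u option) \<Rightarrow> real" where
  "pair_density v F A B \<phi> \<psi> = of_bool (edges_respected F \<phi> A) * of_bool (edges_respected F \<psi> B) *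
     graph_density v (glue (none_edges \<phi> A) (none_edges \<psi> B))"

lemma map_density_glue:
  "map_density v F \<eta> (glue A B) = pair_density v F A B (\<eta> \<circ> shiftL) (\<eta> \<circ> shiftR)"
  by (simp add: map_density_def pair_density_def glue_def none_edges_Un none_edges_image
      edges_respected_Un edges_respected_image)

lemma blend_glue:
  assumes A: "is_plgraph A" "\<Union>A \<subseteq> V" and B: "is_plgraph B" "\<Union>B \<subseteq> V"
    and V: "finite V" and q: "finite (set_pmf q)"
  defines "L \<equiv> V \<inter> range Lab" and "M \<equiv> V \<inter> range Unl"
  shows "blend v q F (glue A B) =
    measure_pmf.expectation (Pi_pmf L None (\<lambda>_. q)) (\<lambda>\<psi>.
    measure_pmf.expectation (Pi_pmf M None (\<lambda>_. q)) (\<lambda>\<phi>.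
    measure_pmf.expectation (Pi_pmf M None (\<lambda>_. q)) (\<lambda>\<phi>'.
      pair_density v F A B (override_on \<phi> \<psi> L) (override_on \<phi>' \<psi> L))))"
proof -
  let ?P = "\<lambda>A. Pi_pmf A None (\<lambda>_. q)"
  let ?W = "L \<union> (shiftL ` M \<union> shiftR ` M)"
  have fin: "finite L" "finite M" using V by (auto simp: L_def M_def)
  have "shiftL x \<in> ?W \<and> shiftR x \<in> ?W" if x: "x \<in> V" for x
  proof (cases "x \<in> M")
    case False
    then obtain n where "x = Lab n" using x by (cases x) (auto simp: M_def)
    then show ?thesis using x by (simp add: L_def)
  qed simp
  then have verts: "\<Union>(glue A B) \<subseteq> ?W"
    using A(2) B(2) unfolding Union_glue by blast
  have "blend v q F (glue A B) = measure_pmf.expectation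
      (map_pmf (\<lambda>\<eta>. (\<eta> \<circ> shiftL, \<eta> \<circ> shiftR)) (?P ?W)) (\<lambda>z. pair_density v F A B (fst z) (snd z))"
    using fin by (simp add: blend_superset[OF _ verts] map_density_glue)
  also have "map_pmf (\<lambda>\<eta>. (\<eta> \<circ> shiftL, \<eta> \<circ> shiftR)) (?P ?W) = ?P L \<bind> (\<lambda>\<psi>. ?P M \<bind> (\<lambda>\<phi>. ?P M \<bind> (\<lambda>\<phi>'.
      return_pmf (override_on \<phi> \<psi> L, override_on \<phi>' \<psi> L))))"
    using fin by (intro Pi_pmf_shift) (auto simp: L_def M_def)
  finally show ?thesis
    using fin q by (simp add: expectation_bind_pmf finite_set_Pi_pmf)
qed

lemma sos_positive_sum:
  assumes "sos_positive d v" "\<And>i. i \<in> I \<Longrightarrow> num_edges (g i) \<le> d"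
  shows "0 \<le> (\<Sum>i\<in>I. \<Sum>j\<in>I. c i * c j * eval_graph v (unlabel (g i + g j)))"
proof -
  have "Poly_Mapping.keys (\<Sum>i\<in>I. Poly_Mapping.single (g i) (c i)) \<subseteq> g ` I"
    using keys_sum[of "\<lambda>i. Poly_Mapping.single (g i) (c i)" I] by (auto split: if_splits)
  then show ?thesis
    using assms by (force simp: sos_positive_def simp flip: eval_comb_unlabel_sum_square)
qed

lemma sos_positive_expectation:
  fixes R :: "'i pmf"
  assumes v: "sos_positive d v" and R: "finite (set_pmf R)"
    and g: "\<And>A \<phi>. A \<in> K \<Longrightarrow> num_edges (g A \<phi>) \<le> d"
  shows "0 \<le> (\<Sum>A\<in>K. \<Sum>B\<in>K. measure_pmf.expectation R (\<lambda>\<phi>. measure_pmf.expectation R (\<lambda>\<phi>'.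
    c A \<phi> * c B \<phi>' * eval_graph v (unlabel (g A \<phi> + g B \<phi>')))))" (is "0 \<le> ?E")
proof -
  let ?S = "set_pmf R"
  have "?E = (\<Sum>A\<in>K. \<Sum>B\<in>K. \<Sum>\<phi>\<in>?S. \<Sum>\<phi>'\<in>?S. (pmf R \<phi> * c A \<phi>) * (pmf R \<phi>' * c B \<phi>') *
      eval_graph v (unlabel (g A \<phi> + g B \<phi>')))"
    using R by (simp add: integral_measure_pmf[of ?S R] sum_distrib_left mult_ac)
  also have "\<dots> = (\<Sum>A\<in>K. \<Sum>\<phi>\<in>?S. \<Sum>B\<in>K. \<Sum>\<phi>'\<in>?S. (pmf R \<phi> * c A \<phi>) * (pmf R \<phi>' * c B \<phi>') *
      eval_graph v (unlabel (g A \<phi> + g B \<phi>')))"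
    by (intro sum.cong refl) (rule sum.swap)
  also have "\<dots> = (\<Sum>(A, \<phi>)\<in>K \<times> ?S. \<Sum>(B, \<phi>')\<in>K \<times> ?S. (pmf R \<phi> * c A \<phi>) * (pmf R \<phi>' * c B \<phi>') *
      eval_graph v (unlabel (g A \<phi> + g B \<phi>')))"
    by (simp add: sum.cartesian_product')
  also have "\<dots> \<ge> 0"
    using sos_positive_sum[OF v, of "K \<times> ?S" "\<lambda>i. g (fst i) (snd i)"
        "\<lambda>i. pmf R (snd i) * c (fst i) (snd i)"] g
    by (simp add: case_prod_unfold mem_Times_iff)
  finally show ?thesis .
qed

lemma sum_pair_density_nonneg:
  fixes F :: "'u set set"
  assumes v: "sos_positive d v" and R: "finite (set_pmf R)"
    and K: "\<And>A. A \<in> K \<Longrightarrow> is_plgraph (E A)" "\<And>A. A \<in> K \<Longrightarrow> card (E A) \<le> d"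
  shows "0 \<le> (\<Sum>A\<in>K. \<Sum>B\<in>K. c A * c B * measure_pmf.expectation R (\<lambda>\<phi>.
    measure_pmf.expectation R (\<lambda>\<phi>'. pair_density v F (E A) (E B) \<phi> \<phi>')))"
proof -
  let ?g = "\<lambda>A \<phi>. abs_plgraph (none_edges \<phi> (E A))"
  let ?c = "\<lambda>A \<phi>. c A * of_bool (edges_respected F \<phi> (E A))"
  have "c A * c B * measure_pmf.expectation R (\<lambda>\<phi>. measure_pmf.expectation R
        (\<lambda>\<phi>'. pair_density v F (E A) (E B) \<phi> \<phi>'))
      = measure_pmf.expectation R (\<lambda>\<phi>. measure_pmf.expectation R
        (\<lambda>\<phi>'. ?c A \<phi> * ?c B \<phi>' * eval_graph v (unlabel (?g A \<phi> + ?g B \<phi>'))))"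
    if "A \<in> K" "B \<in> K" for A B
  proof -
    have "pair_density v F (E A) (E B) \<phi> \<phi>' = of_bool (edges_respected F \<phi> (E A)) *
        of_bool (edges_respected F \<phi>' (E B)) * eval_graph v (unlabel (?g A \<phi> + ?g B \<phi>'))" for \<phi> \<phi>'
      using K(1) that
      by (simp add: pair_density_def graph_density_def plgraph_abs_simps(1) is_plgraph_none_edges)
    then show ?thesis by (simp add: mult_ac)
  qed
  moreover have "num_edges (?g A \<phi>) \<le> d" if "A \<in> K" for A and \<phi> :: "vert \<Rightarrow> 'u option"
    using K[OF that] card_mono[OF is_plgraph_finite none_edges_subset]
    by (fastforce simp: plgraph_abs_simps is_plgraph_none_edges intro: le_trans)
  ultimately show ?thesis using sos_positive_expectation[OF v R, of K ?g ?c] by simp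
qed

lemma sum_blend_glue_nonneg:
  assumes v: "sos_positive d v" and q: "finite (set_pmf q)"
    and K: "finite K" "\<And>A. A \<in> K \<Longrightarrow> is_plgraph (E A)" "\<And>A. A \<in> K \<Longrightarrow> card (E A) \<le> d"
  shows "0 \<le> (\<Sum>A\<in>K. \<Sum>B\<in>K. c A * c B * blend v q F (glue (E A) (E B)))"
proof -
  define V where "V = (\<Union>A\<in>K. \<Union>(E A))"
  have V: "finite V" "\<And>A. A \<in> K \<Longrightarrow> \<Union>(E A) \<subseteq> V"
    unfolding V_def using K is_plgraph_finite_verts by (auto simp del: Union_iff)
  define L where "L = V \<inter> range Lab"
  define M where "M = V \<inter> range Unl"
  let ?PL = "Pi_pmf L None (\<lambda>_. q)" and ?PM = "Pi_pmf M None (\<lambda>_. q)"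
  have fin: "finite (set_pmf ?PL)" "finite (set_pmf ?PM)"
    using V(1) q by (simp_all add: finite_set_Pi_pmf L_def M_def)
  let ?X = "\<lambda>A B \<psi>. measure_pmf.expectation ?PM (\<lambda>\<phi>. measure_pmf.expectation ?PM (\<lambda>\<phi>'.
    pair_density v F (E A) (E B) (override_on \<phi> \<psi> L) (override_on \<phi>' \<psi> L)))"
  have "0 \<le> (\<Sum>A\<in>K. \<Sum>B\<in>K. c A * c B * ?X A B \<psi>)" for \<psi>
    using sum_pair_density_nonneg[OF v, of "map_pmf (\<lambda>\<phi>. override_on \<phi> \<psi> L) ?PM" K E c F] K fin(2)
    by simp
  then have "0 \<le> measure_pmf.expectation ?PL (\<lambda>\<psi>. \<Sum>A\<in>K. \<Sum>B\<in>K. c A * c B * ?X A B \<psi>)"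
    by (rule Bochner_Integration.integral_nonneg)
  also have "\<dots> = (\<Sum>A\<in>K. \<Sum>B\<in>K. c A * c B * measure_pmf.expectation ?PL (?X A B))"
    using fin(1) by (simp add: Bochner_Integration.integral_sum integrable_measure_pmf_finite)
  also have "\<dots> = (\<Sum>A\<in>K. \<Sum>B\<in>K. c A * c B * blend v q F (glue (E A) (E B)))"
    using K(2) V q by (intro sum.cong refl) (simp add: blend_glue[where V = V] L_def M_def)
  finally show ?thesis .
qed

lemma sos_positive_blend:
  assumes v: "sos_positive d v" and q: "finite (set_pmf q)"
  shows "sos_positive d (blend v q F \<circ> rep_plgraph)"
  unfolding sos_positive_def
proof (intro allI impI)
  fix p :: graph_comb assume p: "\<forall>G\<in>Poly_Mapping.keys p. num_edges G \<le> d"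
  have "eval_graph (blend v q F \<circ> rep_plgraph) (unlabel (A + B))
      = blend v q F (glue (rep_plgraph A) (rep_plgraph B))" for A B
  proof -
    let ?G = "glue (rep_plgraph A) (rep_plgraph B)"
    have "A + B = abs_plgraph ?G"
      using plgraph_abs_simps(1)[of "rep_plgraph A" "rep_plgraph B"] by simp
    then show ?thesis
      using graph_density_multiplicative[OF multiplicative_blend[OF q], of ?G]
      by (simp add: graph_density_def is_plgraph_glue)
  qed
  then show "eval_comb (blend v q F \<circ> rep_plgraph) (unlabel_comb (p\<^sup>2)) \<ge> 0"
    unfolding eval_comb_unlabel_square using p
    by (simp add: sum_blend_glue_nonneg[OF v q] num_edges_rep)
qed

lemma blend_in_sos_profile:
  assumes l: "label_bound l" and v: "v \<in> sos_profile l d" and q: "finite (set_pmf q)"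
  shows "restrict (blend v q F \<circ> rep_plgraph) (\<V> l d) \<in> sos_profile l d"
proof (rule restrict_in_sos_profile[OF l])
  show "sos_positive d (blend v q F \<circ> rep_plgraph)"
    using v q by (intro sos_positive_blend) (simp_all add: sos_profile_iff)
  fix C assume "C \<in> \<V> l d"
  then have C: "card (rep_plgraph C) \<le> 2 * d" using l by (simp add: \<V>_eq num_edges_rep)
  have "map_density v F \<phi> (rep_plgraph C) \<ge> 0" for \<phi>
  proof -
    have "card (none_edges \<phi> (rep_plgraph C)) \<le> 2 * d"
      using card_mono[OF is_plgraph_finite[OF is_plgraph_rep] none_edges_subset] C
      by (rule le_trans)
    then have "graph_density v (none_edges \<phi> (rep_plgraph C)) \<ge> 0"
      by (intro sos_profile_graph_density_nonneg[OF l v] is_plgraph_none_edges is_plgraph_rep)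
    then show ?thesis by (simp add: map_density_def)
  qed
  then show "(blend v q F \<circ> rep_plgraph) C \<ge> 0" by (simp add: blend_def)
qed

section \<open>Graphs separate graph combinations\<close>

text \<open>\<open>hom_density r F\<close> is \<open>t(\<cdot>; G)\<close> for the graph \<open>G\<close> with vertex weights \<open>r\<close> and edge set \<open>F\<close>.\<close>

definition hom_density :: "'u pmf \<Rightarrow> 'u set set \<Rightarrow> vert set set \<Rightarrow> real" where
  "hom_density r F E = measure_pmf.prob (Pi_pmf (\<Union>E) undefined (\<lambda>_. r)) {\<phi>. (`) \<phi> ` E \<subseteq> F}"

definition surj_density :: "'u pmf \<Rightarrow> 'u set set \<Rightarrow> vert set set \<Rightarrow> real" where
  "surj_density r F E = measure_pmf.prob (Pi_pmf (\<Union>E) undefined (\<lambda>_. r)) {\<phi>. (`) \<phi> ` E = F}"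

lemma hom_density_eq_sum_surj_density:
  assumes "finite F"
  shows "hom_density r F E = (\<Sum>F'\<in>Pow F. surj_density r F' E)"
proof -
  have "{\<phi>. (`) \<phi> ` E \<subseteq> F} = (\<Union>F'\<in>Pow F. {\<phi>. (`) \<phi> ` E = F'})" by auto
  moreover have "disjoint_family_on (\<lambda>F'. {\<phi>. (`) \<phi> ` E = F'}) (Pow F)"
    by (auto simp: disjoint_family_on_def)
  ultimately show ?thesis
    using assms
    by (simp add: hom_density_def surj_density_def measure_pmf.finite_measure_finite_Union)
qed

lemma surj_density_self_pos:
  assumes "is_plgraph E" "\<Union>E \<subseteq> set_pmf r"
  shows "surj_density r E E > 0"
  unfolding surj_density_def
proof (rule measure_pmf_posI)
  let ?\<phi> = "\<lambda>x. if x \<in> \<Union>E then x else undefined"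
  show "?\<phi> \<in> set_pmf (Pi_pmf (\<Union>E) undefined (\<lambda>_. r))"
    using assms by (auto simp: set_Pi_pmf is_plgraph_finite_verts PiE_dflt_def simp del: Union_iff)
  have "?\<phi> ` e = e" if "e \<in> E" for e using that by force
  then show "?\<phi> \<in> {\<phi>. (`) \<phi> ` E = E}" by simp
qed

lemma surj_density_eq_0: "(\<And>\<phi>. (`) \<phi> ` E \<noteq> F) \<Longrightarrow> surj_density r F E = 0"
  by (simp add: surj_density_def)

lemma eq_0_if_subset_sums_eq_0:
  fixes g :: "'a set \<Rightarrow> 'b :: comm_monoid_add"
  assumes "finite F" "\<And>F'. F' \<subseteq> F \<Longrightarrow> (\<Sum>X\<in>Pow F'. g X) = 0"
  shows "g F = 0"
  using assms
proof (induction rule: finite_psubset_induct)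
  case (psubset F)
  have "g X = 0" if "X \<in> Pow F - {F}" for X
    using that psubset by (intro psubset.IH) auto
  then have "(\<Sum>X\<in>Pow F - {F}. g X) = 0" by (intro sum.neutral) blast
  moreover have "(\<Sum>X\<in>Pow F. g X) = g F + (\<Sum>X\<in>Pow F - {F}. g X)"
    using psubset.hyps by (intro sum.remove) auto
  ultimately show ?case using psubset.prems[of F] by simp
qed

lemma plgraph_iso_if_image_not_smaller:
  assumes E: "is_plgraph E" "\<And>n. Lab n \<notin> \<Union>E" and F: "F = (`) \<phi> ` E" "\<And>n. Lab n \<notin> \<Union>F"
    and card: "card E + card (\<Union>E) \<le> card F + card (\<Union>F)"
  shows "plgraph_iso E F"
proof (rule plgraph_isoI[OF E(1) _ _ F(1)])
  have verts: "\<Union>F = \<phi> ` \<Union>E" unfolding F(1) by (rule Union_image_image)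
  have fin: "finite (\<Union>E)" using E(1) by (rule is_plgraph_finite_verts)
  have "card F \<le> card E" unfolding F(1) using E(1) by (intro card_image_le is_plgraph_finite)
  then have "card (\<Union>E) \<le> card (\<phi> ` \<Union>E)" using card unfolding verts by linarith
  then show "inj_on \<phi> (\<Union>E)"
    using card_image_le[OF fin, of \<phi>] by (intro eq_card_imp_inj_on[OF fin]) linarith
  show "\<phi> x = Lab n \<longleftrightarrow> x = Lab n" if "x \<in> \<Union>E" for x n
    using that E(2) F(2) unfolding verts by (metis imageI)
qed

text \<open>The constituent with the largest number of edges plus vertices has this property.\<close>

lemma obtain_unreachable_constituent:
  assumes "unlabeled_comb b" "b \<noteq> 0"
  obtains H0 where "H0 \<in> Poly_Mapping.keys b"
    "\<And>H \<phi>. H \<in> Poly_Mapping.keys b \<Longrightarrow> (`) \<phi> ` rep_plgraph H = rep_plgraph H0 \<Longrightarrow> H = H0"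
proof -
  let ?size = "\<lambda>H. card (rep_plgraph H) + card (\<Union>(rep_plgraph H))"
  obtain H0 where H0: "H0 \<in> Poly_Mapping.keys b" "\<And>H. H \<in> Poly_Mapping.keys b \<Longrightarrow> ?size H \<le> ?size H0"
  proof -
    have "Max (?size ` Poly_Mapping.keys b) \<in> ?size ` Poly_Mapping.keys b"
      using assms(2) by (intro Max_in) auto
    then show ?thesis using that Max_ge[of "?size ` Poly_Mapping.keys b"] by fastforce
  qed
  have "H = H0"
    if H: "H \<in> Poly_Mapping.keys b" and \<phi>: "(`) \<phi> ` rep_plgraph H = rep_plgraph H0" for H \<phi>
  proof -
    have "unlabeled H" "unlabeled H0" using assms(1) H H0(1) by (simp_all add: unlabeled_comb_def)
    then have "Lab n \<notin> \<Union>(rep_plgraph H)" "Lab n \<notin> \<Union>(rep_plgraph H0)" for n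
      using unlabeled_abs[OF is_plgraph_rep, of H] unlabeled_abs[OF is_plgraph_rep, of H0]
      by simp_all
    then have "plgraph_iso (rep_plgraph H) (rep_plgraph H0)"
      using H0(2)[OF H] \<phi>[symmetric] by (intro plgraph_iso_if_image_not_smaller) simp_all
    then show ?thesis using abs_plgraph_eqI by fastforce
  qed
  then show ?thesis by (rule that[OF H0(1)])
qed

text \<open>
  The density of maps onto the edge set of \<open>H0\<close> is an alternating sum of homomorphism densities into
  the subgraphs of \<open>H0\<close>, and among the constituents it vanishes except at \<open>H0\<close> itself.
\<close>

lemma hom_density_separates:
  assumes b: "unlabeled_comb b" "b \<noteq> 0"
  obtains r :: "vert pmf" and F where "finite (set_pmf r)"
    "(\<Sum>H\<in>Poly_Mapping.keys b. Poly_Mapping.lookup b H * hom_density r F (rep_plgraph H)) \<noteq> 0"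
proof -
  let ?K = "Poly_Mapping.keys b" and ?b = "Poly_Mapping.lookup b"
  obtain H0 where H0: "H0 \<in> ?K"
    and unreachable: "\<And>H \<phi>. H \<in> ?K \<Longrightarrow> (`) \<phi> ` rep_plgraph H = rep_plgraph H0 \<Longrightarrow> H = H0"
    using obtain_unreachable_constituent[OF b] by blast
  let ?E0 = "rep_plgraph H0"
  define r where "r = pmf_of_set (insert (Unl 0) (\<Union>?E0))"
  have set_r: "set_pmf r = insert (Unl 0) (\<Union>?E0)"
    unfolding r_def using is_plgraph_finite_verts[OF is_plgraph_rep]
    by (intro set_pmf_of_set) simp_all
  define g where "g F = (\<Sum>H\<in>?K. ?b H * surj_density r F (rep_plgraph H))" for F
  have "g ?E0 = ?b H0 * surj_density r ?E0 ?E0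
      + (\<Sum>H\<in>?K - {H0}. ?b H * surj_density r ?E0 (rep_plgraph H))"
    unfolding g_def using H0 by (intro sum.remove) auto
  also have "(\<Sum>H\<in>?K - {H0}. ?b H * surj_density r ?E0 (rep_plgraph H)) = 0"
  proof (rule sum.neutral, rule ballI)
    fix H assume "H \<in> ?K - {H0}"
    then have "surj_density r ?E0 (rep_plgraph H) = 0"
      using unreachable by (intro surj_density_eq_0) blast
    then show "?b H * surj_density r ?E0 (rep_plgraph H) = 0" by simp
  qed
  moreover have "surj_density r ?E0 ?E0 > 0" by (rule surj_density_self_pos) (auto simp: set_r)
  ultimately have "g ?E0 \<noteq> 0" using H0 by (simp add: in_keys_iff)
  then obtain F where F: "F \<subseteq> ?E0" "(\<Sum>X\<in>Pow F. g X) \<noteq> 0"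
    using eq_0_if_subset_sums_eq_0 is_plgraph_finite[OF is_plgraph_rep] by blast
  have "(\<Sum>X\<in>Pow F. g X) = (\<Sum>H\<in>?K. ?b H * (\<Sum>X\<in>Pow F. surj_density r X (rep_plgraph H)))"
    unfolding g_def sum_distrib_left by (rule sum.swap)
  also have "\<dots> = (\<Sum>H\<in>?K. ?b H * hom_density r F (rep_plgraph H))"
    using finite_subset[OF F(1) is_plgraph_finite[OF is_plgraph_rep]]
    by (simp add: hom_density_eq_sum_surj_density)
  finally have "(\<Sum>H\<in>?K. ?b H * hom_density r F (rep_plgraph H)) \<noteq> 0" using F(2) by simp
  moreover have "finite (set_pmf r)" using set_r is_plgraph_finite_verts[OF is_plgraph_rep] by simp
  ultimately show ?thesis using that by blast
qed

section \<open>A polynomial curve through a profile\<close>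

definition option_mixture :: "real \<Rightarrow> 'u pmf \<Rightarrow> 'u option pmf" where
  "option_mixture s r = bernoulli_pmf s \<bind> (\<lambda>b. if b then map_pmf Some r else return_pmf None)"

lemma finite_set_option_mixture: "finite (set_pmf r) \<Longrightarrow> finite (set_pmf (option_mixture s r))"
  by (auto simp: option_mixture_def)

lemma pmf_option_mixture:
  assumes "0 \<le> s" "s \<le> 1"
  shows "pmf (option_mixture s r) u
    = s * pmf (map_pmf Some r) u + (1 - s) * pmf (return_pmf None) u"
  unfolding option_mixture_def pmf_bind using assms by simp

lemma option_mixture_0: "option_mixture 0 r = return_pmf None"
  by (rule pmf_eqI) (simp add: pmf_option_mixture)

lemma option_mixture_1: "option_mixture 1 r = map_pmf Some r"
  by (rule pmf_eqI) (simp add: pmf_option_mixture)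

lemma blend_return_None:
  fixes F :: "'u set set"
  assumes "is_plgraph E"
  shows "blend v (return_pmf None) F E = graph_density v E"
proof -
  have "(\<lambda>_. None) ` e = {None}" if "e \<in> E" for e
    using is_plgraph_edge_nonempty[OF assms that] by auto
  then have "none_edges (\<lambda>_. None :: 'u option) E = E" "edges_respected F (\<lambda>_. None) E"
    unfolding none_edges_def edges_respected_def by blast+
  then have "map_density v F (\<lambda>_. None) E = graph_density v E" by (simp add: map_density_def)
  then show ?thesis
    using assms by (simp add: blend_def is_plgraph_finite_verts del: Union_iff)
qed

lemma map_density_Some:
  assumes "is_plgraph E"
  shows "map_density v F (Some \<circ> \<phi>) E = of_bool ((`) \<phi> ` E \<subseteq> F)"
proof -
  have none: "(Some \<circ> \<phi>) ` e \<noteq> {None}" if "e \<in> E" for e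
    using is_plgraph_edge_nonempty[OF assms that] by auto
  have some: "(Some \<circ> \<phi>) ` e \<in> (`) Some ` F \<longleftrightarrow> \<phi> ` e \<in> F" for e
    unfolding image_comp[symmetric] by (auto simp: inj_image_eq_iff)
  have "none_edges (Some \<circ> \<phi>) E = {}" unfolding none_edges_def using none by blast
  moreover have "edges_respected F (Some \<circ> \<phi>) E \<longleftrightarrow> (`) \<phi> ` E \<subseteq> F"
    unfolding edges_respected_def some using none by auto
  ultimately show ?thesis
    by (simp add: map_density_def multiplicative_empty multiplicative_graph_density)
qed

lemma blend_map_Some:
  assumes E: "is_plgraph E"
  shows "blend v (map_pmf Some r) F E = hom_density r F E"
proof -
  let ?V = "\<Union>E"
  have V: "finite ?V" using E by (rule is_plgraph_finite_verts)
  let ?P = "\<lambda>d. Pi_pmf ?V d (\<lambda>_. map_pmf Some r)"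
  have map_density_ext: "map_density v F (\<lambda>x. if x \<in> ?V then \<phi> x else None) E = map_density v F \<phi> E"
    for \<phi>
    by (rule map_density_cong) simp
  have "?P None = map_pmf (\<lambda>\<phi> x. if x \<in> ?V then \<phi> x else None) (?P (Some undefined))"
    by (rule Pi_pmf_default_swap[OF V, symmetric])
  also have "?P (Some undefined) = map_pmf (\<lambda>\<phi>. Some \<circ> \<phi>) (Pi_pmf ?V undefined (\<lambda>_. r))"
    by (rule Pi_pmf_map[OF V refl])
  finally have "blend v (map_pmf Some r) F E = measure_pmf.expectation
      (Pi_pmf ?V undefined (\<lambda>_. r)) (\<lambda>\<phi>. map_density v F (Some \<circ> \<phi>) E)"
    by (simp only: blend_def integral_map_pmf map_density_ext)
  also have "(\<lambda>\<phi>. map_density v F (Some \<circ> \<phi>) E) = indicator {\<phi>. (`) \<phi> ` E \<subseteq> F}"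
    by (rule ext) (simp add: map_density_Some[OF E] indicator_def)
  finally show ?thesis by (simp add: hom_density_def)
qed

lemma blend_option_mixture_poly:
  assumes E: "is_plgraph E" and r: "finite (set_pmf r)"
  shows "\<exists>p. \<forall>s\<in>{0..1}. blend v (option_mixture s r) F E = poly p s"
proof -
  let ?V = "\<Union>E" and ?U = "insert None (Some ` set_pmf r)"
  define W where
    "W u = [:pmf (return_pmf None) u, pmf (map_pmf Some r) u - pmf (return_pmf None) u:]" for u
  have W: "pmf (option_mixture s r) u = poly (W u) s" if "s \<in> {0..1}" for s u
    using that by (simp add: W_def pmf_option_mixture algebra_simps)
  let ?S = "PiE_dflt ?V None (\<lambda>_. ?U)"
  let ?p = "\<Sum>\<phi>\<in>?S. smult (map_density v F \<phi> E) (\<Prod>x\<in>?V. W (\<phi> x))"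
  have "blend v (option_mixture s r) F E = poly ?p s" if s: "s \<in> {0..1}" for s
  proof -
    let ?P = "Pi_pmf ?V None (\<lambda>_. option_mixture s r)"
    have V: "finite ?V" using E by (rule is_plgraph_finite_verts)
    have "set_pmf (option_mixture s r) \<subseteq> ?U" by (auto simp: option_mixture_def split: if_splits)
    then have "set_pmf ?P \<subseteq> ?S" using V by (auto simp: set_Pi_pmf PiE_dflt_def)
    then have "blend v (option_mixture s r) F E = (\<Sum>\<phi>\<in>?S. map_density v F \<phi> E * pmf ?P \<phi>)"
      unfolding blend_def using V r by (intro integral_measure_pmf_real finite_PiE_dflt) auto
    also have "\<dots> = (\<Sum>\<phi>\<in>?S. map_density v F \<phi> E * (\<Prod>x\<in>?V. poly (W (\<phi> x)) s))"
      using V s by (intro sum.cong refl) (auto simp: pmf_Pi' W PiE_dflt_def simp del: Union_iff)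
    finally show ?thesis by (simp add: poly_sum poly_prod)
  qed
  then show ?thesis by blast
qed

lemma eval_comb_blend:
  assumes "finite (set_pmf q)" "unlabeled_comb a"
  shows "eval_comb (blend v q F \<circ> rep_plgraph) a
    = (\<Sum>G\<in>Poly_Mapping.keys a. Poly_Mapping.lookup a G * blend v q F (rep_plgraph G))"
  unfolding eval_comb_def
proof (intro sum.cong refl arg_cong2[where f = "(*)"])
  fix G assume "G \<in> Poly_Mapping.keys a"
  then have "unlabeled G" using assms(2) by (simp add: unlabeled_comb_def)
  then show "eval_graph (blend v q F \<circ> rep_plgraph) G = blend v q F (rep_plgraph G)"
    using graph_density_multiplicative[OF multiplicative_blend[OF assms(1)] is_plgraph_rep]
    by (simp flip: graph_density_unlabeled)
qed

lemma eval_comb_blend_return_None: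
  "unlabeled_comb a \<Longrightarrow> eval_comb (blend v (return_pmf None) F \<circ> rep_plgraph) a = eval_comb v a"
  by (simp add: eval_comb_blend blend_return_None)
    (simp add: eval_comb_def unlabeled_comb_def graph_density_unlabeled)

lemma eval_comb_blend_poly:
  assumes r: "finite (set_pmf r)" and a: "unlabeled_comb a"
  shows "\<exists>p. \<forall>s\<in>{0..1}. eval_comb (blend v (option_mixture s r) F \<circ> rep_plgraph) a = poly p s"
proof -
  have "\<forall>G. \<exists>p. \<forall>s\<in>{0..1}. blend v (option_mixture s r) F (rep_plgraph G) = poly p s"
    using blend_option_mixture_poly[OF is_plgraph_rep r] by blast
  then obtain P where
    P: "\<And>G s. s \<in> {0..1} \<Longrightarrow> blend v (option_mixture s r) F (rep_plgraph G) = poly (P G) s"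
    by metis
  let ?p = "\<Sum>G\<in>Poly_Mapping.keys a. smult (Poly_Mapping.lookup a G) (P G)"
  have "eval_comb (blend v (option_mixture s r) F \<circ> rep_plgraph) a = poly ?p s"
    if "s \<in> {0..1}" for s
    using that by (simp add: eval_comb_blend finite_set_option_mixture r a P poly_sum)
  then show ?thesis by blast
qed

lemma eventually_poly_nonzero:
  fixes p :: "'a :: {idom, t1_space} poly"
  assumes "p \<noteq> 0"
  shows "eventually (\<lambda>s. poly p s \<noteq> 0) (at x within S)"
proof -
  have "\<not> x islimpt {s. poly p s = 0}" using poly_roots_finite[OF assms] islimpt_finite by blast
  then have "eventually (\<lambda>s. poly p s \<noteq> 0) (at x)" by (simp add: islimpt_iff_eventually)
  then show ?thesis by (rule filter_leD[OF at_le[OF subset_UNIV]])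
qed

lemma sos_profile_approx_nonzero:
  assumes l: "label_bound l" and v: "v \<in> sos_profile l d"
    and a: "unlabeled_comb a" "components_in (\<V> l d) a"
    and b: "unlabeled_comb b" "components_in (\<V> l d) b" "b \<noteq> 0"
  obtains w :: "real \<Rightarrow> plgraph \<Rightarrow> real" where
    "\<forall>\<^sub>F s in at_right 0. w s \<in> sos_profile l d \<and> eval_comb (w s) b \<noteq> 0"
    "((\<lambda>s. eval_comb (w s) a) \<longlongrightarrow> eval_comb v a) (at_right 0)"
proof -
  obtain r :: "vert pmf" and F where r: "finite (set_pmf r)" and b_nonzero:
    "(\<Sum>H\<in>Poly_Mapping.keys b. Poly_Mapping.lookup b H * hom_density r F (rep_plgraph H)) \<noteq> 0"
    using hom_density_separates[OF b(1,3)] .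
  let ?u = "\<lambda>s. blend v (option_mixture s r) F \<circ> rep_plgraph"
  define w where "w s = restrict (?u s) (\<V> l d)" for s
  have eval_w: "eval_comb (w s) f = eval_comb (?u s) f" if "components_in (\<V> l d) f" for f s
    unfolding w_def using that by (rule eval_comb_restrict)
  obtain p q where p: "\<And>s. s \<in> {0..1} \<Longrightarrow> eval_comb (?u s) a = poly p s"
    and q: "\<And>s. s \<in> {0..1} \<Longrightarrow> eval_comb (?u s) b = poly q s"
    using eval_comb_blend_poly[OF r] a(1) b(1) by metis
  have small: "\<forall>\<^sub>F s in at_right 0. s \<in> {0..1 :: real}"
    by (rule eventually_at_rightI[of 0 1]) auto
  have "eval_comb (?u 1) b \<noteq> 0"
    using b_nonzero by (simp add: eval_comb_blend option_mixture_1 blend_map_Some r b(1))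
  then have "q \<noteq> 0" using q[of 1] by auto
  then have "\<forall>\<^sub>F s in at_right 0. poly q s \<noteq> 0" by (rule eventually_poly_nonzero)
  with small have "\<forall>\<^sub>F s in at_right 0. w s \<in> sos_profile l d \<and> eval_comb (w s) b \<noteq> 0"
  proof eventually_elim
    case (elim s)
    have "w s \<in> sos_profile l d"
      unfolding w_def by (intro blend_in_sos_profile[OF l v] finite_set_option_mixture r)
    with elim show ?case by (simp add: eval_w b(2) q)
  qed
  moreover have "((\<lambda>s. eval_comb (w s) a) \<longlongrightarrow> eval_comb v a) (at_right 0)"
  proof -
    have "poly p 0 = eval_comb v a"
      using p[of 0] a(1) by (simp add: option_mixture_0 eval_comb_blend_return_None)
    then have "(poly p \<longlongrightarrow> eval_comb v a) (at_right 0)" by (auto intro: tendsto_eq_intros)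
    moreover have "\<forall>\<^sub>F s in at_right 0. poly p s = eval_comb (w s) a"
      using small by eventually_elim (simp add: eval_w a(2) p)
    ultimately show ?thesis by (rule Lim_transform_eventually)
  qed
  ultimately show ?thesis by (rule that)
qed

lemma sos_testable_at_quotient:
  assumes l: "label_bound l" and a: "unlabeled_comb a" "components_in (\<V> l d) a"
    and b: "unlabeled_comb b" "b \<noteq> 0" "sos_testable_at l d b" and ab: "sos_testable_at l d (a * b)"
  shows "sos_testable_at l d a"
  unfolding sos_testable_at_def
proof (intro conjI ballI)
  fix v assume v: "v \<in> sos_profile l d"
  obtain w where
    w: "\<forall>\<^sub>F s in at_right (0 :: real). w s \<in> sos_profile l d \<and> eval_comb (w s) b \<noteq> 0" and
    lim: "((\<lambda>s. eval_comb (w s) a) \<longlongrightarrow> eval_comb v a) (at_right 0)"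
    using sos_profile_approx_nonzero[OF l v a b(1) _ b(2)] b(3)
    unfolding sos_testable_at_def by blast
  from w have "\<forall>\<^sub>F s in at_right 0. eval_comb (w s) a \<ge> 0"
  proof eventually_elim
    case (elim s)
    then have "eval_comb (w s) b > 0" "eval_comb (w s) a * eval_comb (w s) b \<ge> 0"
      using b(3) ab eval_comb_mult[OF a(1) b(1)] by (force simp: sos_testable_at_def order_less_le)+
    then show ?case by (simp add: zero_le_mult_iff)
  qed
  with lim show "eval_comb v a \<ge> 0" by (rule tendsto_lowerbound) simp
qed (rule a(2))

theorem theorem4p16:
  fixes l :: "nat \<Rightarrow> nat" and a b c :: graph_comb
  assumes "label_bound l"
    and "unlabeled_comb a" and "unlabeled_comb b" and "unlabeled_comb c"
    and "b \<noteq> 0"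
    and "sos_testable l b" and "sos_testable l c"
    and "a * b = c"
  shows "sos_testable l a"
proof -
  obtain da where da: "components_in (\<V> l da) a"
    using ex_components_in_\<V>[OF assms(1,2)] by blast
  obtain db where db: "sos_testable_at l db b"
    using assms(6) by (auto simp: sos_testable_iff)
  obtain dc where dc: "sos_testable_at l dc (a * b)"
    using assms(7,8) by (auto simp: sos_testable_iff)
  define d where "d = max da (max db dc)"
  have "components_in (\<V> l d) a"
    using da by (rule components_in_mono) (simp add: \<V>_mono[OF assms(1)] d_def)
  moreover have "sos_testable_at l d b"
    using db by (rule sos_testable_at_mono[OF assms(1)]) (simp add: d_def)
  moreover have "sos_testable_at l d (a * b)"
    using dc by (rule sos_testable_at_mono[OF assms(1)]) (simp add: d_def)
  ultimately have "sos_testable_at l d a"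
    by (rule sos_testable_at_quotient[OF assms(1,2) _ assms(3,5)])
  then show ?thesis using assms(2) by (auto simp: sos_testable_iff)
qed

end
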